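(* Let $f:\mathbb{R}\to\mathbb{R}$. (a) If $f\in ACG_*(\mathbb{R})$ and $f(x)\to0$ as $|x|\to\infty$, then for each $s\neq0$, either both $\widehat f(s)$ and $\widehat{f'}(s)$ fail to exist or $\widehat{f'}(s)=is\widehat f(s)$. (b) Suppose $f\in ACG_*(\mathbb{R})$ and $f,f'\in\mathcal{HK}$. Then for each $s\neq0$, either both $\widehat f(s)$ and $\widehat{f'}(s)$ fail to exist or $\widehat{f'}(s)=is\widehat f(s)$.
   Context: All integrals are Henstock--Kurzweil integrals; complex-valued functions are integrated by real and imaginary parts. $\mathcal{HK}$ is the set of Henstock--Kurzweil integrable functions on $\mathbb{R}$. The Fourier transform is $\widehat f(s)=\int_{-\infty}^\infty e^{-isx}f(x)\,dx$, which exists at $s$ if $x\mapsto e^{-isx}f(x)$ is in $\mathcal{HK}$. A function $F$ is $AC_*$ on a set $E\subset\mathbb{R}$ if for each $\epsilon>0$ there is $\delta>0$ such that for every finite collection of disjoint intervals $(s_i,t_i)$ with endpoints in $E$ and $\sum|t_i-s_i|<\delta$, the sum of the oscillations $\sup_{[p,q]\subset[s_i,t_i]}|F(p)-F(q)|$ is less than $\epsilon$. $F\in ACG_*(\mathbb{R})$ means $F$ is continuous on $\mathbb{R}$ and $\mathbb{R}=\bigcup_{n=1}^\infty E_n$ with $F$ being $AC_*$ on each $E_n$. Such an $F$ is differentiable almost everywhere, and $f'$ denotes the almost-everywhere derivative. *)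

theory Defs
  imports "HOL-Analysis.Analysis"
begin

text \<open>The oscillation takes values in the extended reals, so that the supremum of an unbounded set
  is \<open>\<infinity>\<close> and not an unspecified real number.\<close>

definition oscillation :: "(real \<Rightarrow> real) \<Rightarrow> real \<Rightarrow> real \<Rightarrow> ereal" where
  "oscillation F s t = (SUP (p, q)\<in>{(p, q). s \<le> p \<and> p \<le> q \<and> q \<le> t}. ereal \<bar>F p - F q\<bar>)"

text \<open>A finite collection of disjoint open intervals is encoded as the finite set of its pairs of
  endpoints; nonempty disjoint intervals are distinct, so nothing is lost by using a set.\<close>

definition AC_star :: "(real \<Rightarrow> real) \<Rightarrow> real set \<Rightarrow> bool" where
  "AC_star F E \<longleftrightarrow>
    (\<forall>\<epsilon>>0. \<exists>\<delta>>0. \<forall>C :: (real \<times> real) set.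
      finite C \<longrightarrow>
      (\<forall>(s, t)\<in>C. s \<in> E \<and> t \<in> E \<and> s < t) \<longrightarrow>
      disjoint_family_on (\<lambda>(s, t). {s<..<t}) C \<longrightarrow>
      (\<Sum>(s, t)\<in>C. \<bar>t - s\<bar>) < \<delta> \<longrightarrow>
      (\<Sum>(s, t)\<in>C. oscillation F s t) < ereal \<epsilon>)"

definition ACG_star :: "(real \<Rightarrow> real) \<Rightarrow> bool" where
  "ACG_star F \<longleftrightarrow>
    continuous_on UNIV F \<and>
    (\<exists>E :: nat \<Rightarrow> real set. (\<Union>n. E n) = UNIV \<and> (\<forall>n. AC_star F (E n)))"

text \<open>On \<open>UNIV\<close>, \<open>integrable_on\<close> asks for Henstock--Kurzweil integrability on all compact
  intervals together with convergence of the integrals over \<open>[a, b]\<close> as \<open>a\<close> and \<open>b\<close> tend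
  independently to \<open>-\<infinity>\<close> and \<open>\<infinity>\<close>; by Hake's theorem this is Henstock--Kurzweil integrability
  on the real line. For complex-valued functions it is equivalent to integrability of the real and
  imaginary parts.\<close>

definition fourier_integrand :: "(real \<Rightarrow> real) \<Rightarrow> real \<Rightarrow> real \<Rightarrow> complex" where
  "fourier_integrand f s x = exp (- (\<i> * of_real s * of_real x)) * of_real (f x)"

definition fourier_exists :: "(real \<Rightarrow> real) \<Rightarrow> real \<Rightarrow> bool" where
  "fourier_exists f s \<longleftrightarrow> fourier_integrand f s integrable_on UNIV"

definition fourier :: "(real \<Rightarrow> real) \<Rightarrow> real \<Rightarrow> complex" where
  "fourier f s = integral UNIV (fourier_integrand f s)"

text \<open>For \<open>f\<close> in \<open>ACG\<^sub>*\<close> the almost-everywhere derivative is represented below by \<open>deriv f\<close>, which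
  is the derivative wherever \<open>f\<close> is differentiable. Its unspecified values on the remaining null
  set affect neither integrability nor integrals.\<close>

end

theory Submission
  imports Defs
begin

text \<open>Fix \<open>s \<noteq> 0\<close> and put \<open>e(x) = exp (- i s x)\<close>. The theorem is integration by parts,
  \[ \int_a^b e\, f' = e(b) f(b) - e(a) f(a) + i s \int_a^b e\, f , \]
  followed by \<open>a \<rightarrow> -\<infinity>\<close> and \<open>b \<rightarrow> \<infinity>\<close>. Since \<open>|e| = 1\<close>, the boundary terms vanish in the limit as soon
  as \<open>f\<close> vanishes at infinity, and then, because \<open>i s \<noteq> 0\<close>, either of the two improper integrals exists
  when the other does. When \<open>f\<close> and \<open>f'\<close> are integrable on the line, \<open>f\<close> does vanish at infinity: the
  increments \<open>f b - f a = \<integral> f'\<close> far out are small, and a function that is nearly constant and not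
  small there would have large integrals over long intervals. So the second part follows from
  the first.

  Integration by parts itself is the fundamental theorem of calculus for the product \<open>e f\<close>, whose
  derivative is \<open>e f' - i s e f\<close> off the set \<open>N\<close> where \<open>f\<close> is not differentiable. Two facts about
  \<open>ACG\<^sub>*\<close> functions make it available.

  First, \<open>N\<close> is a null set (\<open>ACG_star_imp_ae_differentiable\<close>). On a short piece \<open>E\<close> of one of the sets
  where \<open>f\<close> is \<open>AC\<^sub>*\<close>, the sums of oscillations are bounded, so there is an increasing function \<open>W\<close>
  with \<open>|f p - f x| \<le> W y - W x\<close> whenever \<open>x \<le> p \<le> y\<close> and \<open>x, y \<in> E\<close>. On \<open>E\<close> the function
  \<open>f\<close> is thus a difference of increasing functions, and the bound by \<open>W\<close>, together with the density of
  \<open>E\<close> around almost all of its points, turns differentiability along \<open>E\<close> into differentiability in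
  the ordinary sense. The theorem on monotone functions (\<open>mono_imp_ae_differentiable\<close>) comes from Vitali's covering theorem.

  Secondly, \<open>f\<close> has no variation on null sets (\<open>ACG_star_imp_null_variation_right\<close>): for intervals
  tagged in a null set and fine enough, the increments from the tags have arbitrarily small total.
  This property passes to the product of \<open>f\<close> with a Lipschitz function, and it is what the
  fundamental theorem (\<open>fundamental_theorem_of_calculus_null_variation\<close>) needs on the exceptional
  set.\<close>

section \<open>Null sets and open covers\<close>

lemma negligible_if_countable: "countable S \<Longrightarrow> negligible S"
  by (simp add: countable_imp_null_set_lborel negligible_iff_null_sets null_sets_completionI)

lemma negligible_outer_open:
  assumes "negligible S" "0 < e"
  obtains U where "open U" "S \<subseteq> U" "U \<in> lmeasurable" "measure lebesgue U < e"
proof -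
  obtain U where U: "open U" "S \<subseteq> U" "U - S \<in> lmeasurable" "emeasure lebesgue (U - S) < ennreal e"
    by (rule sets_lebesgue_outer_open[OF negligible_imp_sets[OF assms(1)] assms(2)])
  have S: "S \<in> null_sets lebesgue" using assms(1) by (simp add: negligible_iff_null_sets)
  have eq: "U = (U - S) \<union> S" using U(2) by blast
  have "U \<in> lmeasurable"
    using fmeasurable.Un[OF U(3) negligible_imp_measurable[OF assms(1)]] eq by simp
  moreover have "measure lebesgue U = measure lebesgue (U - S)"
    using measure_Un_null_set[OF fmeasurableD[OF U(3)] S] eq by simp
  moreover have "measure lebesgue (U - S) < e"
    using U(3,4) by (simp add: emeasure_eq_measure2 ennreal_less_iff)
  ultimately show thesis using U(1,2) that by simp
qed

text \<open>A null set may be left uncovered, which is what applications of Vitali's theorem do. Stated with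
  covers, the criterion serves sets whose measurability is not known.\<close>

lemma negligible_if_small_open_covers:
  fixes A :: "real set"
  assumes "\<And>e. 0 < e \<Longrightarrow> \<exists>U. open U \<and> bounded U \<and> negligible (A - U) \<and> measure lebesgue U \<le> e"
  shows "negligible A"
  unfolding negligible_outer_le
proof (intro allI impI)
  fix e :: real assume "0 < e"
  then obtain U where U: "open U" "bounded U" "negligible (A - U)" "measure lebesgue U \<le> e"
    using assms by blast
  have Um: "U \<in> lmeasurable" using U by (simp add: lmeasurable_open)
  have "measure lebesgue (U \<union> (A - U)) \<le> measure lebesgue U + measure lebesgue (A - U)"
    using Um U(3) by (intro measure_Un_le) (auto simp: negligible_imp_sets)
  also have "\<dots> \<le> e" using U by (simp add: negligible_imp_measure0)
  finally show "\<exists>T. A \<subseteq> T \<and> T \<in> lmeasurable \<and> measure lebesgue T \<le> e"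
    using fmeasurable.Un[OF Um negligible_imp_measurable[OF U(3)]]
    by (intro exI[of _ "U \<union> (A - U)"]) auto
qed

section \<open>Monotone functions are differentiable almost everywhere\<close>

text \<open>Induction on the number of intervals, splitting off the one with the largest left endpoint. With
  \<open>F\<close> the identity this bounds the total length.\<close>

lemma sum_increments_le:
  fixes F :: "real \<Rightarrow> real"
  assumes "mono F" "finite C" "c \<le> d"
    and "\<And>u v. (u, v) \<in> C \<Longrightarrow> c \<le> u \<and> u < v \<and> v \<le> d"
    and "disjoint_family_on (\<lambda>(u, v). {u<..<v}) C"
  shows "(\<Sum>(u, v)\<in>C. F v - F u) \<le> F d - F c"
  using assms(2-)
proof (induction "card C" arbitrary: C d)
  case 0
  then show ?case using \<open>mono F\<close> by (simp add: monoD)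
next
  case (Suc n)
  have "C \<noteq> {}" using Suc.hyps(2) by auto
  define m where "m = Max (fst ` C)"
  have "m \<in> fst ` C" unfolding m_def using \<open>C \<noteq> {}\<close> Suc.prems(1) by simp
  then obtain v where mv: "(m, v) \<in> C" by force
  have mle: "u \<le> m" if "(u, w) \<in> C" for u w
    unfolding m_def using that Suc.prems(1) by (metis Max_ge finite_imageI fst_conv image_eqI)
  let ?C = "C - {(m, v)}"
  have right: "w \<le> m" if "(u, w) \<in> ?C" for u w
  proof (rule ccontr)
    assume "\<not> w \<le> m"
    have "{u<..<w} \<inter> {m<..<v} = {}"
      using disjoint_family_onD[OF Suc.prems(4), of "(u, w)" "(m, v)"] that mv by auto
    moreover have "m < min w v" using \<open>\<not> w \<le> m\<close> Suc.prems(3)[OF mv] by auto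
    then obtain z where "m < z" "z < min w v" using dense by blast
    ultimately show False using mle[of u w] that by auto
  qed
  have "(\<Sum>(u, v)\<in>?C. F v - F u) \<le> F m - F c"
  proof (rule Suc.hyps(1))
    show "n = card ?C" using Suc.hyps(2) mv Suc.prems(1) by simp
    show "c \<le> m" using Suc.prems(3)[OF mv] by simp
    show "disjoint_family_on (\<lambda>(u, v). {u<..<v}) ?C"
      using Suc.prems(4) disjoint_family_on_mono by blast
    show "c \<le> u \<and> u < w \<and> w \<le> m" if "(u, w) \<in> ?C" for u w
      using Suc.prems(3)[of u w] right[OF that] that by auto
  qed (use Suc.prems in auto)
  moreover have "(\<Sum>(u, v)\<in>C. F v - F u) = (F v - F m) + (\<Sum>(u, v)\<in>?C. F v - F u)"
    using sum.remove[OF Suc.prems(1) mv, of "\<lambda>(u, v). F v - F u"] by simp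
  moreover have "F v \<le> F d" using Suc.prems(3)[OF mv] \<open>mono F\<close> by (simp add: monoD)
  ultimately show ?case by linarith
qed

text \<open>Vitali's theorem for closed balls, restated for pairs of endpoints. The endpoints of a countable
  family form a null set, so the open intervals still cover almost everything; being open, they can
  serve as the region to be covered in a further application.\<close>

lemma Vitali_covering_intervals:
  fixes S :: "real set" and K :: "(real \<times> real) set"
  assumes cov: "\<And>x d. x \<in> S \<Longrightarrow> 0 < d \<Longrightarrow> \<exists>u v. (u, v) \<in> K \<and> u < v \<and> u \<le> x \<and> x \<le> v \<and> v - u < d"
  obtains C where "countable C" "C \<subseteq> K" "\<And>u v. (u, v) \<in> C \<Longrightarrow> u < v"
    "disjoint_family_on (\<lambda>(u, v). {u<..<v}) C"
    "negligible (S - (\<Union>(u, v)\<in>C. {u<..<v}))"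
proof -
  let ?K = "{(u, v) \<in> K. u < v}"
  let ?a = "\<lambda>(u, v). (u + v) / 2 :: real" and ?r = "\<lambda>(u, v). (v - u) / 2 :: real"
  have cb: "cball (?a i) (?r i) = {fst i..snd i}" for i :: "real \<times> real"
    by (cases i) (simp add: cball_eq_atLeastAtMost field_simps)
  obtain C where C: "countable C" "C \<subseteq> ?K"
     "pairwise (\<lambda>i j. disjnt (cball (?a i) (?r i)) (cball (?a j) (?r j))) C"
     "negligible (S - (\<Union>i\<in>C. cball (?a i) (?r i)))"
  proof (rule Vitali_covering_theorem_cballs[of ?K ?r S ?a])
    show "\<exists>i. i \<in> ?K \<and> x \<in> cball (?a i) (?r i) \<and> ?r i < d" if "x \<in> S" "0 < d" for x d
    proof -
      from cov[OF that] obtain u v where "(u, v) \<in> K" "u < v" "u \<le> x" "x \<le> v" "v - u < d" by blast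
      then show ?thesis using cb[of "(u, v)"] by (intro exI[of _ "(u, v)"]) auto
    qed
    show "0 < ?r i" if "i \<in> ?K" for i
      using that by auto
  qed (rule that)
  show thesis
  proof
    show "countable C" "C \<subseteq> K" "\<And>u v. (u, v) \<in> C \<Longrightarrow> u < v" using C(1,2) by auto
    show "disjoint_family_on (\<lambda>(u, v). {u<..<v}) C"
      unfolding disjoint_family_on_def
    proof (intro ballI impI)
      fix i j assume "i \<in> C" "j \<in> C" "i \<noteq> j"
      then have "disjnt {fst i..snd i} {fst j..snd j}"
        using pairwiseD[OF C(3)] unfolding cb by blast
      then have "disjnt {fst i<..<snd i} {fst j<..<snd j}"
        by (meson disjnt_subset1 disjnt_subset2 greaterThanLessThan_subseteq_atLeastAtMost_iff order_refl)
      then show "(case i of (u, v) \<Rightarrow> {u<..<v}) \<inter> (case j of (u, v) \<Rightarrow> {u<..<v}) = {}"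
        by (simp add: disjnt_def case_prod_unfold)
    qed
    have "countable (fst ` C \<union> snd ` C)" using C(1) by simp
    then have "negligible ((S - (\<Union>i\<in>C. cball (?a i) (?r i))) \<union> (fst ` C \<union> snd ` C))"
      using C(4) negligible_if_countable negligible_Un by blast
    then show "negligible (S - (\<Union>(u, v)\<in>C. {u<..<v}))"
    proof (rule negligible_subset)
      show "S - (\<Union>(u, v)\<in>C. {u<..<v}) \<subseteq> (S - (\<Union>i\<in>C. cball (?a i) (?r i))) \<union> (fst ` C \<union> snd ` C)"
      proof
        fix x assume x: "x \<in> S - (\<Union>(u, v)\<in>C. {u<..<v})"
        show "x \<in> (S - (\<Union>i\<in>C. cball (?a i) (?r i))) \<union> (fst ` C \<union> snd ` C)"
        proof (cases "\<exists>i\<in>C. x \<in> {fst i..snd i}")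
          case True
          then obtain i where i: "i \<in> C" "fst i \<le> x" "x \<le> snd i" by auto
          moreover have "\<not> (fst i < x \<and> x < snd i)"
            using x i(1) by (cases i) auto
          ultimately have "x = fst i \<or> x = snd i" by auto
          with i(1) show ?thesis by blast
        next
          case False
          with x show ?thesis unfolding cb by blast
        qed
      qed
    qed
  qed
qed

text \<open>Slopes are taken over intervals that contain \<open>x\<close> instead of starting there: Vitali's theorem
  then applies directly, and only two kinds of extreme slope are needed in place of four Dini
  derivatives.\<close>

definition steep_at :: "(real \<Rightarrow> real) \<Rightarrow> real \<Rightarrow> real \<Rightarrow> bool" where
  "steep_at F q x \<longleftrightarrow>
    (\<forall>e>0. \<exists>u v. u < v \<and> u \<le> x \<and> x \<le> v \<and> v - u < e \<and> q * (v - u) \<le> F v - F u)"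

definition shallow_at :: "(real \<Rightarrow> real) \<Rightarrow> real \<Rightarrow> real \<Rightarrow> bool" where
  "shallow_at F p x \<longleftrightarrow>
    (\<forall>e>0. \<exists>u v. u < v \<and> u \<le> x \<and> x \<le> v \<and> v - u < e \<and> F v - F u \<le> p * (v - u))"

text \<open>Disjoint intervals of slope at least \<open>q\<close> within \<open>[c, d]\<close> have total length at most
  \<open>(F d - F c) / q\<close>, because their increments add up to at most \<open>F d - F c\<close>.\<close>

lemma steep_set_cover:
  fixes F :: "real \<Rightarrow> real"
  assumes "mono F" "0 < q" "c \<le> d"
    and steep: "\<And>x. x \<in> A \<Longrightarrow> steep_at F q x"
  obtains U where "open U" "U \<subseteq> {c<..<d}" "negligible (A \<inter> {c<..<d} - U)"
    "measure lebesgue U \<le> (F d - F c) / q"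
proof -
  define K where "K = {(u, v). c \<le> u \<and> v \<le> d \<and> q * (v - u) \<le> F v - F u}"
  obtain C where C: "countable C" "C \<subseteq> K" "\<And>u v. (u, v) \<in> C \<Longrightarrow> u < v"
    "disjoint_family_on (\<lambda>(u, v). {u<..<v}) C"
    "negligible (A \<inter> {c<..<d} - (\<Union>(u, v)\<in>C. {u<..<v}))"
  proof (rule Vitali_covering_intervals[of "A \<inter> {c<..<d}" K])
    fix x e :: real assume x: "x \<in> A \<inter> {c<..<d}" and "0 < e"
    then have "0 < min e (min (x - c) (d - x))" by auto
    from steep[unfolded steep_at_def, rule_format, OF _ this] x
    obtain u v where "u < v" "u \<le> x" "x \<le> v" "v - u < min e (min (x - c) (d - x))"
      "q * (v - u) \<le> F v - F u" by blast
    then show "\<exists>u v. (u, v) \<in> K \<and> u < v \<and> u \<le> x \<and> x \<le> v \<and> v - u < e"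
      unfolding K_def by (intro exI[of _ u] exI[of _ v]) auto
  qed blast
  let ?U = "\<Union>(u, v)\<in>C. {u<..<v}"
  have sub: "?U \<subseteq> {c<..<d}" using C(2) by (auto simp: K_def)
  have fin: "measure lebesgue (\<Union>(u, v)\<in>D. {u<..<v}) \<le> (F d - F c) / q"
    if D: "D \<subseteq> C" "finite D" for D
  proof -
    have "measure lebesgue (\<Union>(u, v)\<in>D. {u<..<v}) \<le> (\<Sum>i\<in>D. measure lebesgue (case i of (u, v) \<Rightarrow> {u<..<v}))"
      by (rule measure_UNION_le) (use D in auto)
    also have "\<dots> = (\<Sum>(u, v)\<in>D. v - u)"
      by (rule sum.cong) (use C(3) D(1) in \<open>force+\<close>)
    also have "\<dots> \<le> (\<Sum>(u, v)\<in>D. (F v - F u) / q)"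
      by (rule sum_mono) (use C(2) D(1) \<open>0 < q\<close> in \<open>auto simp: K_def field_simps\<close>)
    also have "\<dots> = (\<Sum>(u, v)\<in>D. F v - F u) / q"
      by (simp add: sum_divide_distrib case_prod_unfold)
    also have "\<dots> \<le> (F d - F c) / q"
    proof -
      have "(\<Sum>(u, v)\<in>D. F v - F u) \<le> F d - F c"
        using C D disjoint_family_on_mono[OF D(1) C(4)]
        by (intro sum_increments_le) (use assms in \<open>auto simp: K_def\<close>)
      then show ?thesis using \<open>0 < q\<close> by (simp add: divide_right_mono)
    qed
    finally show ?thesis .
  qed
  show thesis
  proof
    show "open ?U" by auto
    show "?U \<subseteq> {c<..<d}" by (rule sub)
    show "negligible (A \<inter> {c<..<d} - ?U)" by (rule C)
    show "measure lebesgue ?U \<le> (F d - F c) / q"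
    proof (rule measure_UN_bound)
      show "measure lebesgue (\<Union>i\<in>D. case i of (u, v) \<Rightarrow> {u<..<v}) \<le> (F d - F c) / q"
        if "D \<subseteq> C" "finite D" for D
        using fin that by blast
    qed (use C(1) in auto)
  qed
qed

text \<open>Cover almost all of \<open>A\<close> by disjoint intervals in \<open>U\<close> of slope at most \<open>p\<close>: the increments of \<open>F\<close>
  over them total at most \<open>p\<close> times the measure of \<open>U\<close>. Covering \<open>A\<close> again inside each of them by
  intervals of slope at least \<open>q\<close> divides the increments by \<open>q\<close>.\<close>

lemma shallow_steep_cover_shrink:
  fixes F :: "real \<Rightarrow> real"
  assumes "mono F" "0 \<le> p" "0 < q" "open U" "U \<subseteq> {a<..<b}"
    and shallow: "\<And>x. x \<in> A \<Longrightarrow> shallow_at F p x"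
    and steep: "\<And>x. x \<in> A \<Longrightarrow> steep_at F q x"
  obtains V where "open V" "V \<subseteq> U" "negligible (A \<inter> U - V)"
    "measure lebesgue V \<le> p / q * measure lebesgue U"
proof -
  define K where "K = {(u, v). {u..v} \<subseteq> U \<and> F v - F u \<le> p * (v - u)}"
  obtain C where C: "countable C" "C \<subseteq> K" "\<And>u v. (u, v) \<in> C \<Longrightarrow> u < v"
    "disjoint_family_on (\<lambda>(u, v). {u<..<v}) C"
    "negligible (A \<inter> U - (\<Union>(u, v)\<in>C. {u<..<v}))"
  proof (rule Vitali_covering_intervals[of "A \<inter> U" K])
    fix x e :: real assume x: "x \<in> A \<inter> U" and "0 < e"
    obtain r where r: "0 < r" "ball x r \<subseteq> U"
      using \<open>open U\<close> x openE by blast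
    then have "0 < min e r" using \<open>0 < e\<close> by auto
    from shallow[unfolded shallow_at_def, rule_format, OF _ this] x
    obtain u v where uv: "u < v" "u \<le> x" "x \<le> v" "v - u < min e r" "F v - F u \<le> p * (v - u)" by blast
    then have "{u..v} \<subseteq> ball x r" by (auto simp: dist_real_def)
    then show "\<exists>u v. (u, v) \<in> K \<and> u < v \<and> u \<le> x \<and> x \<le> v \<and> v - u < e"
      unfolding K_def using uv r(2) by (intro exI[of _ u] exI[of _ v]) auto
  qed (rule that)
  have "\<exists>V. open V \<and> V \<subseteq> {fst i<..<snd i} \<and> negligible (A \<inter> {fst i<..<snd i} - V) \<and>
      measure lebesgue V \<le> (F (snd i) - F (fst i)) / q" if "i \<in> C" for i
  proof -
    have "fst i \<le> snd i" using C(3)[of "fst i" "snd i"] that by simp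
    from steep_set_cover[OF \<open>mono F\<close> \<open>0 < q\<close> this steep] show ?thesis by metis
  qed
  then obtain V where V: "\<And>i. i \<in> C \<Longrightarrow> open (V i)" "\<And>i. i \<in> C \<Longrightarrow> V i \<subseteq> {fst i<..<snd i}"
    "\<And>i. i \<in> C \<Longrightarrow> negligible (A \<inter> {fst i<..<snd i} - V i)"
    "\<And>i. i \<in> C \<Longrightarrow> measure lebesgue (V i) \<le> (F (snd i) - F (fst i)) / q"
    by metis
  have iU: "{fst i<..<snd i} \<subseteq> U" if "i \<in> C" for i
    using C(2) that unfolding K_def by force
  have "bounded U"
    using assms(5) bounded_subset[OF bounded_box[of a b]] by simp
  then have Um: "U \<in> lmeasurable"
    using \<open>open U\<close> by (rule lmeasurable_open)
  have Vm: "V i \<in> lmeasurable" if "i \<in> C" for i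
    using V(1)[OF that] bounded_subset[OF \<open>bounded U\<close> order_trans[OF V(2)[OF that] iU[OF that]]]
    by (simp add: lmeasurable_open)
  show thesis
  proof
    show "open (\<Union>(V ` C))" using V(1) by blast
    show "\<Union>(V ` C) \<subseteq> U" using V(2) iU by blast
    have "negligible ((A \<inter> U - (\<Union>(u, v)\<in>C. {u<..<v})) \<union> (\<Union>i\<in>C. A \<inter> {fst i<..<snd i} - V i))"
      using C(1,5) V(3) by (intro negligible_Un negligible_countable_Union) auto
    then show "negligible (A \<inter> U - \<Union>(V ` C))"
    proof (rule negligible_subset)
      show "A \<inter> U - \<Union>(V ` C) \<subseteq> (A \<inter> U - (\<Union>(u, v)\<in>C. {u<..<v})) \<union> (\<Union>i\<in>C. A \<inter> {fst i<..<snd i} - V i)"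
        by (fastforce simp: case_prod_unfold)
    qed
    show "measure lebesgue (\<Union>(V ` C)) \<le> p / q * measure lebesgue U"
    proof (rule measure_UN_bound)
      fix D assume D: "D \<subseteq> C" "finite D"
      have "measure lebesgue (\<Union>(V ` D)) \<le> (\<Sum>i\<in>D. measure lebesgue (V i))"
        using D Vm by (intro measure_UNION_le) auto
      also have "\<dots> \<le> (\<Sum>i\<in>D. p / q * (snd i - fst i))"
      proof (rule sum_mono)
        fix i assume i: "i \<in> D"
        then have "measure lebesgue (V i) \<le> (F (snd i) - F (fst i)) / q" using V(4) D by blast
        also have "\<dots> \<le> p * (snd i - fst i) / q"
          using C(2) D i \<open>0 < q\<close> by (intro divide_right_mono) (auto simp: K_def)
        finally show "measure lebesgue (V i) \<le> p / q * (snd i - fst i)" by simp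
      qed
      also have "\<dots> = p / q * measure lebesgue (\<Union>i\<in>D. {fst i<..<snd i})"
      proof -
        have "measure lebesgue (\<Union>i\<in>D. {fst i<..<snd i}) = (\<Sum>i\<in>D. measure lebesgue {fst i<..<snd i})"
          using D(2) disjoint_family_on_mono[OF D(1) C(4)]
          by (intro measure_UNION') (auto simp: case_prod_unfold pairwise_def disjnt_def disjoint_family_on_def)
        also have "\<dots> = (\<Sum>i\<in>D. snd i - fst i)"
          using C(3) D by (intro sum.cong) (auto simp: less_imp_le)
        finally show ?thesis by (simp add: sum_distrib_left)
      qed
      also have "\<dots> \<le> p / q * measure lebesgue U"
      proof (rule mult_left_mono)
        show "measure lebesgue (\<Union>i\<in>D. {fst i<..<snd i}) \<le> measure lebesgue U"
        proof (rule measure_mono_fmeasurable)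
          show "(\<Union>i\<in>D. {fst i<..<snd i}) \<subseteq> U" using iU D(1) by blast
          show "(\<Union>i\<in>D. {fst i<..<snd i}) \<in> sets lebesgue" using D(2) by auto
        qed (rule Um)
      qed (use assms(2,3) in simp)
      finally show "measure lebesgue (\<Union>(V ` D)) \<le> p / q * measure lebesgue U" .
    qed (use C(1) Vm in auto)
  qed
qed

text \<open>Repeating the shrinking step gives covers of measure at most \<open>(p / q) ^ n * (b - a)\<close>.\<close>

lemma negligible_shallow_steep:
  fixes F :: "real \<Rightarrow> real"
  assumes "mono F" "0 \<le> p" "p < q"
    and "\<And>x. x \<in> A \<Longrightarrow> shallow_at F p x" "\<And>x. x \<in> A \<Longrightarrow> steep_at F q x"
    and "A \<subseteq> {a<..<b}"
  shows "negligible A"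
proof (cases "a < b")
  case True
  have pq: "0 < q" "0 \<le> p / q" "p / q < 1" using assms(2,3) by auto
  have "\<exists>U. open U \<and> U \<subseteq> {a<..<b} \<and> negligible (A - U) \<and>
      measure lebesgue U \<le> (p / q) ^ n * (b - a)" for n
  proof (induction n)
    case 0
    have "A - {a<..<b} = {}" using assms(6) by blast
    then show ?case using True by (intro exI[of _ "{a<..<b}"]) simp
  next
    case (Suc n)
    then obtain U where U: "open U" "U \<subseteq> {a<..<b}" "negligible (A - U)"
      "measure lebesgue U \<le> (p / q) ^ n * (b - a)" by blast
    obtain V where V: "open V" "V \<subseteq> U" "negligible (A \<inter> U - V)"
      "measure lebesgue V \<le> p / q * measure lebesgue U"
      by (rule shallow_steep_cover_shrink[OF assms(1,2) pq(1) U(1,2) assms(4,5)])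
    have "measure lebesgue V \<le> p / q * ((p / q) ^ n * (b - a))"
      using V(4) mult_left_mono[OF U(4) pq(2)] by linarith
    moreover have "negligible (A - V)"
      using negligible_Un[OF U(3) V(3)] by (rule negligible_subset) blast
    ultimately show ?case using V U by (intro exI[of _ V]) (auto simp: mult.assoc)
  qed
  note covers = this
  show ?thesis
  proof (rule negligible_if_small_open_covers)
    fix e :: real assume "0 < e"
    then have "0 < e / (b - a)" using True by simp
    then obtain n where "(p / q) ^ n < e / (b - a)"
      using real_arch_pow_inv[OF _ pq(3)] by blast
    then have "(p / q) ^ n * (b - a) < e" using True by (simp add: field_simps)
    moreover obtain U where U: "open U" "U \<subseteq> {a<..<b}" "negligible (A - U)"
      "measure lebesgue U \<le> (p / q) ^ n * (b - a)" using covers by blast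
    moreover have "bounded U" using U(2) bounded_subset[OF bounded_box[of a b]] by simp
    ultimately show "\<exists>U. open U \<and> bounded U \<and> negligible (A - U) \<and> measure lebesgue U \<le> e"
      by (intro exI[of _ U]) auto
  qed
next
  case False
  then have "A = {}" using assms(6) by auto
  then show ?thesis by simp
qed

lemma negligible_infinitely_steep:
  fixes F :: "real \<Rightarrow> real"
  assumes "mono F" and "\<And>x q. x \<in> A \<Longrightarrow> 0 < q \<Longrightarrow> steep_at F q x" and "A \<subseteq> {a<..<b}"
  shows "negligible A"
proof (cases "a < b")
  case True
  show ?thesis
  proof (rule negligible_if_small_open_covers)
    fix e :: real assume "0 < e"
    \<comment> \<open>Adding 1 keeps \<open>q\<close> positive when \<open>F\<close> is constant.\<close>
    define q where "q = (F b - F a + 1) / e"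
    have inc: "F a \<le> F b" using True \<open>mono F\<close> by (simp add: monoD)
    then have "0 < q" unfolding q_def using \<open>0 < e\<close> by simp
    obtain U where U: "open U" "U \<subseteq> {a<..<b}" "negligible (A \<inter> {a<..<b} - U)"
      "measure lebesgue U \<le> (F b - F a) / q"
      using steep_set_cover[of F q a b A] assms(1,2) \<open>0 < q\<close> True by (metis less_imp_le)
    have "(F b - F a) / q \<le> e"
      using inc \<open>0 < e\<close> by (simp add: q_def field_simps)
    moreover have "A \<inter> {a<..<b} = A" using assms(3) by blast
    moreover have "bounded U" using U(2) bounded_subset[OF bounded_box[of a b]] by simp
    ultimately show "\<exists>U. open U \<and> bounded U \<and> negligible (A - U) \<and> measure lebesgue U \<le> e"
      using U by (intro exI[of _ U]) auto
  qed
next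
  case False
  then have "A = {}" using assms(3) by auto
  then show ?thesis by simp
qed

text \<open>If no two rationals separate small from large slopes, then the infimum of the \<open>p\<close> for which \<open>F\<close> is
  shallow at \<open>x\<close> is both the lower and the upper limit of the slopes, hence the derivative.\<close>

lemma differentiable_or_slopes_oscillate:
  fixes F :: "real \<Rightarrow> real"
  assumes "mono F" and not_steep: "\<not> steep_at F M x"
    and gap: "\<And>p q. p \<in> \<rat> \<Longrightarrow> q \<in> \<rat> \<Longrightarrow> 0 \<le> p \<Longrightarrow> p < q \<Longrightarrow> shallow_at F p x \<Longrightarrow> \<not> steep_at F q x"
  shows "F differentiable (at x)"
proof -
  define S where "S = {p. shallow_at F p x}"
  obtain e0 where e0: "0 < e0"
    "\<And>u v. u < v \<Longrightarrow> u \<le> x \<Longrightarrow> x \<le> v \<Longrightarrow> v - u < e0 \<Longrightarrow> F v - F u < M * (v - u)"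
    using not_steep unfolding steep_at_def by (meson not_le)
  have up: "q \<in> S" if "p \<in> S" "p \<le> q" for p q
    unfolding S_def mem_Collect_eq shallow_at_def
  proof (intro allI impI)
    fix e :: real assume "0 < e"
    then obtain u v where uv: "u < v" "u \<le> x" "x \<le> v" "v - u < e" "F v - F u \<le> p * (v - u)"
      using \<open>p \<in> S\<close> unfolding S_def mem_Collect_eq shallow_at_def by blast
    moreover have "p * (v - u) \<le> q * (v - u)" using \<open>p \<le> q\<close> uv(1) by (simp add: mult_right_mono)
    ultimately have "F v - F u \<le> q * (v - u)" by linarith
    with uv show "\<exists>u v. u < v \<and> u \<le> x \<and> x \<le> v \<and> v - u < e \<and> F v - F u \<le> q * (v - u)"
      by blast
  qed
  have "M \<in> S"
    unfolding S_def mem_Collect_eq shallow_at_def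
  proof (intro allI impI)
    fix e :: real assume "0 < e"
    then obtain h where "0 < h" "h < e" "h < e0"
      using dense[of 0 "min e e0"] e0(1) by auto
    then show "\<exists>u v. u < v \<and> u \<le> x \<and> x \<le> v \<and> v - u < e \<and> F v - F u \<le> M * (v - u)"
      using e0(2)[of x "x + h"] by (intro exI[of _ x] exI[of _ "x + h"]) auto
  qed
  have lower: "0 \<le> p" if p: "p \<in> S" for p
  proof -
    obtain u v where uv: "u < v" "F v - F u \<le> p * (v - u)"
      using p unfolding S_def mem_Collect_eq shallow_at_def by (meson zero_less_one)
    then have "0 \<le> p * (v - u)" using monoD[OF \<open>mono F\<close>, of u v] by linarith
    then show ?thesis using uv(1) by (simp add: zero_le_mult_iff)
  qed
  define L where "L = Inf S"
  have bdd: "bdd_below S" using lower by (rule bdd_belowI)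
  have "(F has_derivative (\<lambda>h. h * L)) (at x)"
    unfolding has_derivative_at_alt
  proof (intro conjI allI impI)
    fix e :: real assume "0 < e"
    have "L - e \<notin> S" using cInf_lower[OF _ bdd, of "L - e"] \<open>0 < e\<close> unfolding L_def by auto
    then obtain d1 where d1: "0 < d1"
      "\<And>u v. u < v \<Longrightarrow> u \<le> x \<Longrightarrow> x \<le> v \<Longrightarrow> v - u < d1 \<Longrightarrow> (L - e) * (v - u) < F v - F u"
      unfolding S_def mem_Collect_eq shallow_at_def by (meson not_le)
    obtain r where r: "r \<in> S" "r < L + e"
      using cInf_lessD[of S "L + e"] \<open>M \<in> S\<close> \<open>0 < e\<close> unfolding L_def by force
    obtain p where p: "p \<in> \<rat>" "r < p" "p < L + e" using Rats_dense_in_real[OF r(2)] by blast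
    obtain q where q: "q \<in> \<rat>" "p < q" "q < L + e" using Rats_dense_in_real[OF p(3)] by blast
    have "p \<in> S" using up[OF r(1)] p(2) by simp
    then have "\<not> steep_at F q x" using gap[OF p(1) q(1) lower q(2)] unfolding S_def by blast
    then obtain d2 where d2: "0 < d2"
      "\<And>u v. u < v \<Longrightarrow> u \<le> x \<Longrightarrow> x \<le> v \<Longrightarrow> v - u < d2 \<Longrightarrow> F v - F u < q * (v - u)"
      unfolding steep_at_def by (meson not_le)
    have est: "\<bar>F v - F u - (v - u) * L\<bar> \<le> e * (v - u)"
      if "u < v" "u \<le> x" "x \<le> v" "v - u < min d1 d2" for u v
    proof -
      have "(L - e) * (v - u) < F v - F u" using d1(2) that by simp
      moreover have "F v - F u < q * (v - u)" using d2(2) that by simp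
      moreover have "q * (v - u) \<le> (L + e) * (v - u)" using q(3) that by (simp add: mult_right_mono)
      ultimately show ?thesis by (simp add: algebra_simps abs_le_iff)
    qed
    show "\<exists>d>0. \<forall>y. norm (y - x) < d \<longrightarrow> norm (F y - F x - (y - x) * L) \<le> e * norm (y - x)"
    proof (intro exI[of _ "min d1 d2"] conjI allI impI)
      fix y assume y: "norm (y - x) < min d1 d2"
      consider "y = x" | "x < y" | "y < x" by linarith
      then show "norm (F y - F x - (y - x) * L) \<le> e * norm (y - x)"
      proof cases
        case 2
        then show ?thesis using est[of x y] y by simp
      next
        case 3
        then show ?thesis using est[of y x] y by (simp add: algebra_simps abs_minus_commute)
      qed simp
    qed (use d1 d2 in simp)
  qed (rule bounded_linear_mult_left)
  then show ?thesis unfolding differentiable_def by blast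
qed

text \<open>Lebesgue's theorem. A point without derivative has either arbitrarily large slopes or slopes on
  both sides of a rational gap; localised to bounded intervals, these are countably many null
  sets.\<close>

theorem mono_imp_ae_differentiable:
  fixes F :: "real \<Rightarrow> real"
  assumes "mono F"
  shows "negligible {x. \<not> F differentiable (at x)}"
proof -
  define A where "A n p q = {x \<in> {- real n<..<real n}. shallow_at F p x \<and> steep_at F q x}" for n p q
  define B where "B n = {x \<in> {- real n<..<real n}. \<forall>q>0. steep_at F q x}" for n
  have "negligible (A n p q)" if "0 \<le> p" "p < q" for n p q
    by (rule negligible_shallow_steep[OF assms that, of _ "- real n" "real n"]) (auto simp: A_def)
  moreover have "negligible (B n)" for n
    by (rule negligible_infinitely_steep[OF assms, of _ "- real n" "real n"]) (auto simp: B_def)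
  moreover have "countable {(p, q). p \<in> \<rat> \<and> q \<in> \<rat> \<and> 0 \<le> p \<and> p < (q::real)}"
    by (rule countable_subset[of _ "\<rat> \<times> \<rat>"]) (auto simp: countable_rat)
  ultimately have "negligible ((\<Union>n. B n) \<union>
      (\<Union>n. \<Union>(p, q)\<in>{(p, q). p \<in> \<rat> \<and> q \<in> \<rat> \<and> 0 \<le> p \<and> p < q}. A n p q))"
    by (intro negligible_Un negligible_countable_Union countable_image) auto
  then show ?thesis
  proof (rule negligible_subset, intro subsetI)
    fix x assume "x \<in> {x. \<not> F differentiable (at x)}"
    then have nd: "\<not> F differentiable (at x)" by simp
    obtain n where "\<bar>x\<bar> < real n" using reals_Archimedean2 by blast
    then have n: "x \<in> {- real n<..<real n}" by auto
    show "x \<in> (\<Union>n. B n) \<union> (\<Union>n. \<Union>(p, q)\<in>{(p, q). p \<in> \<rat> \<and> q \<in> \<rat> \<and> 0 \<le> p \<and> p < q}. A n p q)"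
    proof (cases "\<forall>q>0. steep_at F q x")
      case True
      then show ?thesis using n unfolding B_def by blast
    next
      case False
      then obtain M where "\<not> steep_at F M x" by blast
      then obtain p q where pq: "p \<in> \<rat>" "q \<in> \<rat>" "0 \<le> p" "p < q" "shallow_at F p x" "steep_at F q x"
        using differentiable_or_slopes_oscillate[OF assms] nd by blast
      then have "x \<in> A n p q" using n unfolding A_def by blast
      then show ?thesis using pq(1-4) by blast
    qed
  qed
qed

section \<open>Asymptotic density of a set of reals around its points\<close>

text \<open>The gaps to the right of such points are disjoint, and each contains a rational.\<close>

lemma countable_right_isolated:
  fixes E :: "real set"
  shows "countable {x \<in> E. \<exists>\<eta>>0. {x<..<x + \<eta>} \<inter> E = {}}" (is "countable ?R")
proof -
  have "\<forall>x\<in>?R. \<exists>\<eta>>0. {x<..<x + \<eta>} \<inter> E = {}" by blast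
  from bchoice[OF this] obtain \<eta> where
    \<eta>: "\<And>x. x \<in> ?R \<Longrightarrow> 0 < \<eta> x" "\<And>x. x \<in> ?R \<Longrightarrow> {x<..<x + \<eta> x} \<inter> E = {}"
    by blast
  have "\<forall>x\<in>?R. \<exists>r\<in>\<rat>. x < r \<and> r < x + \<eta> x"
    using \<eta>(1) by (intro ballI Rats_dense_in_real) simp
  then have "\<forall>x\<in>?R. \<exists>r. r \<in> \<rat> \<and> x < r \<and> r < x + \<eta> x" by blast
  from bchoice[OF this] obtain r where r: "\<And>x. x \<in> ?R \<Longrightarrow> r x \<in> \<rat> \<and> x < r x \<and> r x < x + \<eta> x"
    by blast
  have less: "r x < r y" if "x \<in> ?R" "y \<in> ?R" "x < y" for x y
  proof -
    have "x + \<eta> x \<le> y" using \<eta>(2)[OF that(1)] that by (force simp: not_le)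
    then show ?thesis using r[OF that(1)] r[OF that(2)] by linarith
  qed
  have "inj_on r ?R"
    by (rule linorder_inj_onI) (use less in force)+
  moreover have "countable (r ` ?R)"
    using r by (intro countable_subset[OF _ countable_rat]) blast
  ultimately show ?thesis by (rule countable_image_inj_on[rotated])
qed

text \<open>A one-sided form of the density theorem that makes sense for arbitrary sets: near almost
  every \<open>x \<in> E\<close>, each point \<open>z\<close> has a point of \<open>E\<close> to its left at a distance of \<open>o(|z - x|)\<close>. The
  supremum \<open>S z\<close> of \<open>E\<close> up to \<open>z\<close> is increasing in \<open>z\<close> and is the identity on \<open>E\<close>. So it is
  differentiable almost everywhere, and its derivative is \<open>1\<close> at every point of \<open>E\<close> that is a
  limit of points of \<open>E\<close> from the right and where the derivative exists; hence
  \<open>S z = z + o(|z - x|)\<close>.\<close>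

lemma ae_point_asymptotically_dense:
  fixes E :: "real set"
  assumes "E \<subseteq> {a<..<b}"
  shows "negligible {x \<in> E. \<not> (\<forall>\<epsilon>>0. \<exists>\<delta>>0. \<forall>z. \<bar>z - x\<bar> < \<delta> \<longrightarrow>
           (\<exists>e\<in>E. z - \<epsilon> * \<bar>z - x\<bar> \<le> e \<and> e \<le> z))}"
proof -
  \<comment> \<open>The point \<open>a\<close> keeps the set nonempty; it lies below \<open>E\<close> and is ruled out later by \<open>a < z - \<epsilon> * \<bar>z - x\<bar>\<close>.\<close>
  define S where "S z = Sup (insert a (E \<inter> {..z}))" for z
  have bdd: "bdd_above (insert a (E \<inter> {..z}))" for z
    by (rule bdd_aboveI[of _ "max a z"]) auto
  have "mono S"
    unfolding S_def by (intro monoI cSup_subset_mono bdd) auto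
  have S_E: "S x = x" if "x \<in> E" for x
    unfolding S_def using that assms by (intro cSup_eq_maximum) auto
  let ?R = "{x \<in> E. \<exists>\<eta>>0. {x<..<x + \<eta>} \<inter> E = {}}"
  have "negligible ({x. \<not> S differentiable (at x)} \<union> ?R)"
    using mono_imp_ae_differentiable[OF \<open>mono S\<close>] negligible_if_countable[OF countable_right_isolated]
    by (rule negligible_Un)
  then show ?thesis
  proof (rule negligible_subset, intro subsetI)
    fix x assume "x \<in> {x \<in> E. \<not> (\<forall>\<epsilon>>0. \<exists>\<delta>>0. \<forall>z. \<bar>z - x\<bar> < \<delta> \<longrightarrow>
           (\<exists>e\<in>E. z - \<epsilon> * \<bar>z - x\<bar> \<le> e \<and> e \<le> z))}"
    then have x: "x \<in> E" "\<not> (\<forall>\<epsilon>>0. \<exists>\<delta>>0. \<forall>z. \<bar>z - x\<bar> < \<delta> \<longrightarrow>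
           (\<exists>e\<in>E. z - \<epsilon> * \<bar>z - x\<bar> \<le> e \<and> e \<le> z))" by auto
    show "x \<in> {x. \<not> S differentiable (at x)} \<union> ?R"
    proof (rule ccontr)
      assume "x \<notin> {x. \<not> S differentiable (at x)} \<union> ?R"
      then have "S differentiable (at x)" and acc: "\<And>\<eta>. 0 < \<eta> \<Longrightarrow> \<exists>e\<in>E. x < e \<and> e < x + \<eta>"
        using x(1) by fastforce+
      then obtain D where "(S has_real_derivative D) (at x)"
        using real_differentiable_def by blast
      then have D: "\<exists>d>0. \<forall>z. \<bar>z - x\<bar> < d \<longrightarrow> \<bar>S z - x - D * (z - x)\<bar> \<le> \<epsilon> * \<bar>z - x\<bar>" if "0 < \<epsilon>" for \<epsilon>
        using that unfolding has_field_derivative_def has_derivative_at_alt real_norm_def S_E[OF x(1)] by blast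
      have "\<bar>1 - D\<bar> \<le> 0 + \<epsilon>" if \<epsilon>: "0 < \<epsilon>" for \<epsilon>
      proof -
        obtain d where d: "0 < d" "\<And>z. \<bar>z - x\<bar> < d \<Longrightarrow> \<bar>S z - x - D * (z - x)\<bar> \<le> \<epsilon> * \<bar>z - x\<bar>"
          using D[OF \<epsilon>] by blast
        obtain e where e: "e \<in> E" "x < e" "e < x + d" using acc[OF d(1)] by blast
        have "\<bar>(1 - D) * (e - x)\<bar> \<le> \<epsilon> * (e - x)"
          using d(2)[of e] e S_E[OF e(1)] by (simp add: algebra_simps)
        then show ?thesis using e by (simp add: abs_mult)
      qed
      then have "D = 1" using field_le_epsilon[of "\<bar>1 - D\<bar>" 0] by simp
      have "\<exists>\<delta>>0. \<forall>z. \<bar>z - x\<bar> < \<delta> \<longrightarrow> (\<exists>e\<in>E. z - \<epsilon> * \<bar>z - x\<bar> \<le> e \<and> e \<le> z)" if \<epsilon>: "0 < \<epsilon>" for \<epsilon>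
      proof -
        obtain d where d: "0 < d" "\<And>z. \<bar>z - x\<bar> < d \<Longrightarrow> \<bar>S z - x - D * (z - x)\<bar> \<le> \<epsilon> / 2 * \<bar>z - x\<bar>"
          using D[of "\<epsilon> / 2"] \<open>0 < \<epsilon>\<close> by auto
        have "a < x" using x(1) assms by auto
        \<comment> \<open>The second bound ensures \<open>z - \<epsilon> * \<bar>z - x\<bar> > a\<close>.\<close>
        define \<delta> where "\<delta> = min d ((x - a) / (1 + \<epsilon>))"
        have "0 < \<delta>" unfolding \<delta>_def using d(1) \<open>a < x\<close> \<open>0 < \<epsilon>\<close> by simp
        moreover have "\<exists>e\<in>E. z - \<epsilon> * \<bar>z - x\<bar> \<le> e \<and> e \<le> z" if "\<bar>z - x\<bar> < \<delta>" for z
        proof (cases "z = x")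
          case True
          then show ?thesis using x(1) by auto
        next
          case False
          then have pos: "0 < \<epsilon> * \<bar>z - x\<bar>" using \<open>0 < \<epsilon>\<close> by simp
          have "\<bar>z - x\<bar> < (x - a) / (1 + \<epsilon>)" using that by (simp add: \<delta>_def)
          then have "\<bar>z - x\<bar> * (1 + \<epsilon>) < x - a" using \<open>0 < \<epsilon>\<close> by (simp add: pos_less_divide_eq)
          then have a: "a < z - \<epsilon> * \<bar>z - x\<bar>" by (simp add: algebra_simps)
          have "\<bar>S z - z\<bar> \<le> (\<epsilon> * \<bar>z - x\<bar>) / 2" using d(2)[of z] that \<open>D = 1\<close> by (simp add: \<delta>_def)
          then have "z - \<epsilon> * \<bar>z - x\<bar> < S z" using pos by linarith
          then obtain e where "e \<in> insert a (E \<inter> {..z})" "z - \<epsilon> * \<bar>z - x\<bar> < e"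
            unfolding S_def less_cSup_iff[OF insert_not_empty bdd] by blast
          then show ?thesis using a by (intro bexI[of _ e]) auto
        qed
        ultimately show ?thesis by blast
      qed
      then show False using x(2) by blast
    qed
  qed
qed

section \<open>Almost everywhere differentiability of \<open>ACG\<^sub>*\<close> functions\<close>

text \<open>Boundedness keeps the supremum finite to the right of \<open>E\<close>; to the left of \<open>E\<close> a lower bound is the
  value.\<close>

lemma mono_on_extend:
  fixes g :: "real \<Rightarrow> real"
  assumes g: "mono_on E g" and "bounded (g ` E)"
  obtains h where "mono h" "\<And>x. x \<in> E \<Longrightarrow> h x = g x"
proof -
  obtain m where m: "\<And>x. x \<in> E \<Longrightarrow> \<bar>g x\<bar> \<le> m"
    using assms(2) unfolding bounded_iff by auto
  define h where "h z = Sup (insert (- m) (g ` (E \<inter> {..z})))" for z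
  have bdd: "bdd_above (insert (- m) (g ` (E \<inter> {..z})))" for z
    by (rule bdd_aboveI[of _ "max m (- m)"]) (use m in fastforce)
  show thesis
  proof
    show "mono h"
      unfolding h_def by (intro monoI cSup_subset_mono bdd) auto
    show "h x = g x" if "x \<in> E" for x
      unfolding h_def
    proof (rule cSup_eq_maximum)
      fix y assume "y \<in> insert (- m) (g ` (E \<inter> {..x}))"
      then show "y \<le> g x" using m[OF that] that mono_onD[OF g] by (auto simp: abs_le_iff)
    qed (use that in auto)
  qed
qed

text \<open>On \<open>E\<close> we have \<open>F = (W + F) - W\<close>, a difference of increasing functions, and \<open>W + F\<close> extends to an
  increasing function \<open>G\<close> on the line. Let \<open>W\<close> and \<open>G\<close> be differentiable at \<open>x \<in> E\<close>, and let \<open>E\<close> be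
  asymptotically dense there. A point \<open>p\<close> near \<open>x\<close> lies between points \<open>e1\<close>, \<open>e2\<close> of \<open>E\<close> with
  \<open>e2 - e1 = o(|p - x|)\<close>. Then \<open>F e1 - F x\<close> is \<open>l (e1 - x)\<close> up to a small error, where
  \<open>l = G' x - W' x\<close>, and \<open>|F p - F e1| \<le> W e2 - W e1 = o(|p - x|)\<close>. So \<open>l\<close> is the derivative
  of \<open>F\<close> at \<open>x\<close>.\<close>

lemma ae_differentiable_if_controlled:
  fixes F :: "real \<Rightarrow> real"
  assumes E: "E \<subseteq> {a<..<b}" and "mono W"
    and ctrl: "\<And>x y p. x \<in> E \<Longrightarrow> y \<in> E \<Longrightarrow> x \<le> p \<Longrightarrow> p \<le> y \<Longrightarrow> \<bar>F p - F x\<bar> \<le> W y - W x"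
  shows "negligible {x \<in> E. \<not> F differentiable (at x)}"
proof -
  have bnd: "bounded ((\<lambda>x. W x + F x) ` E)"
  proof (cases "E = {}")
    case False
    then obtain c where c: "c \<in> E" by blast
    have "\<bar>W x + F x\<bar> \<le> \<bar>W c + F c\<bar> + 2 * (W b - W a)" if x: "x \<in> E" for x
    proof -
      have *: "\<bar>F y - F z\<bar> \<le> W b - W a \<and> \<bar>W y - W z\<bar> \<le> W b - W a" if "y \<in> E" "z \<in> E" "z \<le> y" for y z
      proof -
        have "W a \<le> W z" "W z \<le> W y" "W y \<le> W b"
          using that E by (auto intro!: monoD[OF \<open>mono W\<close>])
        then show ?thesis using ctrl[of z y y] that by auto
      qed
      show ?thesis using *[OF x c] *[OF c x] by (cases "c \<le> x") auto
    qed
    then show ?thesis unfolding bounded_iff by auto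
  qed simp
  have "mono_on E (\<lambda>x. W x + F x)"
  proof (rule mono_onI)
    fix x y assume "x \<in> E" "y \<in> E" "x \<le> y"
    then show "W x + F x \<le> W y + F y" using ctrl[of x y y] by auto
  qed
  then obtain G where G: "mono G" "\<And>x. x \<in> E \<Longrightarrow> G x = W x + F x"
    using mono_on_extend[OF _ bnd] by blast
  let ?dense = "\<lambda>x. \<forall>\<epsilon>>0. \<exists>\<delta>>0. \<forall>z. \<bar>z - x\<bar> < \<delta> \<longrightarrow> (\<exists>e\<in>E. z - \<epsilon> * \<bar>z - x\<bar> \<le> e \<and> e \<le> z)"
  have "negligible ({x. \<not> W differentiable (at x)} \<union> {x. \<not> G differentiable (at x)} \<union> {x \<in> E. \<not> ?dense x})"
    using mono_imp_ae_differentiable \<open>mono W\<close> \<open>mono G\<close> ae_point_asymptotically_dense[OF E]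
    by (intro negligible_Un) auto
  then show ?thesis
  proof (rule negligible_subset, intro subsetI)
    fix x assume "x \<in> {x \<in> E. \<not> F differentiable (at x)}"
    then have x: "x \<in> E" "\<not> F differentiable (at x)" by auto
    show "x \<in> {x. \<not> W differentiable (at x)} \<union> {x. \<not> G differentiable (at x)} \<union> {x \<in> E. \<not> ?dense x}"
    proof (rule ccontr)
      assume "\<not> ?thesis"
      then have "W differentiable (at x)" "G differentiable (at x)" and dense: "?dense x"
        using x(1) by auto
      then obtain w g where "(W has_real_derivative w) (at x)" "(G has_real_derivative g) (at x)"
        using real_differentiable_def by blast
      then have W': "\<exists>d>0. \<forall>z. \<bar>z - x\<bar> < d \<longrightarrow> \<bar>W z - W x - w * (z - x)\<bar> \<le> \<epsilon> * \<bar>z - x\<bar>"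
        and G': "\<exists>d>0. \<forall>z. \<bar>z - x\<bar> < d \<longrightarrow> \<bar>G z - G x - g * (z - x)\<bar> \<le> \<epsilon> * \<bar>z - x\<bar>" if "0 < \<epsilon>" for \<epsilon>
        using that unfolding has_field_derivative_def has_derivative_at_alt real_norm_def by blast+
      define l where "l = g - w"
      define M where "M = 8 + 3 * \<bar>w\<bar> + \<bar>l\<bar>"
      have "(F has_real_derivative l) (at x)"
        unfolding has_field_derivative_def has_derivative_at_alt real_norm_def
      proof (intro conjI allI impI)
        fix e :: real assume "0 < e"
        have "0 < M" by (simp add: M_def add_pos_nonneg)
        define \<epsilon> where "\<epsilon> = min (1 / 2) (e / M)"
        have \<epsilon>: "0 < \<epsilon>" "\<epsilon> \<le> 1 / 2" "M * \<epsilon> \<le> e"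
          using \<open>0 < e\<close> \<open>0 < M\<close> by (auto simp: \<epsilon>_def min_def field_simps)
        obtain d1 where d1: "0 < d1" "\<And>z. \<bar>z - x\<bar> < d1 \<Longrightarrow> \<bar>W z - W x - w * (z - x)\<bar> \<le> \<epsilon> * \<bar>z - x\<bar>"
          using W'[OF \<epsilon>(1)] by blast
        obtain d2 where d2: "0 < d2" "\<And>z. \<bar>z - x\<bar> < d2 \<Longrightarrow> \<bar>G z - G x - g * (z - x)\<bar> \<le> \<epsilon> * \<bar>z - x\<bar>"
          using G'[OF \<epsilon>(1)] by blast
        obtain d3 where d3: "0 < d3"
          "\<And>z. \<bar>z - x\<bar> < d3 \<Longrightarrow> \<exists>e\<in>E. z - \<epsilon> * \<bar>z - x\<bar> \<le> e \<and> e \<le> z"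
          using dense \<epsilon>(1) by blast
        define d where "d = min d1 (min d2 d3) / 2"
        have "\<bar>F p - F x - l * (p - x)\<bar> \<le> e * \<bar>p - x\<bar>" if p: "\<bar>p - x\<bar> < d" for p
        proof -
          define r where "r = \<bar>p - x\<bar>"
          have r: "0 \<le> r" "2 * r < d1" "2 * r < d2" "2 * r < d3"
            using p by (auto simp: r_def d_def)
          have er: "0 \<le> \<epsilon> * r" "2 * (\<epsilon> * r) \<le> r"
            using \<epsilon> r(1) mult_right_mono[of \<epsilon> "1 / 2" r] by auto
          obtain e1 where e1: "e1 \<in> E" "p - \<epsilon> * r \<le> e1" "e1 \<le> p"
            using d3(2)[of p] r unfolding r_def by auto
          \<comment> \<open>Density gives points of \<open>E\<close> to the left only; applied at \<open>z\<close>, slightly beyond \<open>p\<close>, it gives a point that is still to the right of \<open>p\<close>.\<close>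
          define z where "z = p + 2 * (\<epsilon> * r)"
          have zr: "\<bar>z - x\<bar> \<le> 2 * r" using er r_def unfolding z_def by linarith
          have ez: "\<epsilon> * \<bar>z - x\<bar> \<le> 2 * (\<epsilon> * r)" using mult_left_mono[OF zr, of \<epsilon>] \<epsilon>(1) by simp
          obtain e2 where e2: "e2 \<in> E" "p \<le> e2" "e2 \<le> p + 2 * (\<epsilon> * r)"
            using d3(2)[of z] zr r ez unfolding z_def by fastforce
          have near: "\<bar>e1 - x\<bar> \<le> 2 * r" "\<bar>e2 - x\<bar> \<le> 2 * r"
            using e1 e2 er r_def by linarith+
          have nearer: "\<epsilon> * \<bar>e1 - x\<bar> \<le> 2 * (\<epsilon> * r)" "\<epsilon> * \<bar>e2 - x\<bar> \<le> 2 * (\<epsilon> * r)"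
            using mult_left_mono[OF near(1), of \<epsilon>] mult_left_mono[OF near(2), of \<epsilon>] \<epsilon>(1) by simp_all
          have W1: "\<bar>W e1 - W x - w * (e1 - x)\<bar> \<le> 2 * (\<epsilon> * r)"
            using d1(2)[of e1] near nearer r by linarith
          have W2: "\<bar>W e2 - W x - w * (e2 - x)\<bar> \<le> 2 * (\<epsilon> * r)"
            using d1(2)[of e2] near nearer r by linarith
          have G1: "\<bar>G e1 - G x - g * (e1 - x)\<bar> \<le> 2 * (\<epsilon> * r)"
            using d2(2)[of e1] near nearer r by linarith
          have "\<bar>w * (e2 - e1)\<bar> \<le> \<bar>w\<bar> * (3 * (\<epsilon> * r))"
            unfolding abs_mult using e1 e2 by (intro mult_left_mono) auto
          moreover have "w * (e2 - e1) = w * (e2 - x) - w * (e1 - x)" by (simp add: algebra_simps)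
          moreover have "\<bar>F p - F e1\<bar> \<le> W e2 - W e1" using ctrl e1 e2 by blast
          ultimately have 1: "\<bar>F p - F e1\<bar> \<le> 4 * (\<epsilon> * r) + 3 * (\<bar>w\<bar> * (\<epsilon> * r))"
            using W1 W2 by linarith
          have "F e1 - F x - l * (e1 - x) = (G e1 - G x - g * (e1 - x)) - (W e1 - W x - w * (e1 - x))"
            using G(2)[OF e1(1)] G(2)[OF x(1)] unfolding l_def by (simp add: algebra_simps)
          then have 2: "\<bar>F e1 - F x - l * (e1 - x)\<bar> \<le> 4 * (\<epsilon> * r)" using W1 G1 by linarith
          have 3: "\<bar>l * (e1 - p)\<bar> \<le> \<bar>l\<bar> * (\<epsilon> * r)"
            unfolding abs_mult using e1 by (intro mult_left_mono) auto
          have "F p - F x - l * (p - x) = (F p - F e1) + (F e1 - F x - l * (e1 - x)) + l * (e1 - p)"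
            by (simp add: algebra_simps)
          then have "\<bar>F p - F x - l * (p - x)\<bar> \<le> 8 * (\<epsilon> * r) + 3 * (\<bar>w\<bar> * (\<epsilon> * r)) + \<bar>l\<bar> * (\<epsilon> * r)"
            using 1 2 3 by linarith
          also have "\<dots> = M * (\<epsilon> * r)" by (simp add: M_def algebra_simps)
          also have "\<dots> \<le> e * r"
            using mult_right_mono[OF \<epsilon>(3) r(1)] by (simp add: mult.assoc)
          finally show ?thesis by (simp add: r_def)
        qed
        moreover have "0 < d" using d1 d2 d3 by (simp add: d_def)
        ultimately show "\<exists>d>0. \<forall>y. \<bar>y - x\<bar> < d \<longrightarrow> \<bar>F y - F x - l * (y - x)\<bar> \<le> e * \<bar>y - x\<bar>" by blast
      qed (rule bounded_linear_mult_right)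
      then show False using x(2) real_differentiable_def by blast
    qed
  qed
qed

lemma oscillation_le_iff:
  "oscillation F s t \<le> ereal c \<longleftrightarrow> (\<forall>p q. s \<le> p \<longrightarrow> p \<le> q \<longrightarrow> q \<le> t \<longrightarrow> \<bar>F p - F q\<bar> \<le> c)"
  unfolding oscillation_def SUP_le_iff by auto

lemma oscillation_ge: "s \<le> p \<Longrightarrow> p \<le> q \<Longrightarrow> q \<le> t \<Longrightarrow> ereal \<bar>F p - F q\<bar> \<le> oscillation F s t"
  unfolding oscillation_def by (rule SUP_upper2[of "(p, q)"]) auto

lemma oscillation_nonneg: "s \<le> t \<Longrightarrow> 0 \<le> oscillation F s t"
  using oscillation_ge[of s s s t F] by (simp add: zero_ereal_def)

lemma AC_starE:
  assumes "AC_star F E" "0 < \<epsilon>"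
  obtains \<delta> where "0 < \<delta>" "\<And>C. finite C \<Longrightarrow> \<forall>(s, t)\<in>C. s \<in> E \<and> t \<in> E \<and> s < t \<Longrightarrow>
      disjoint_family_on (\<lambda>(s, t). {s<..<t}) C \<Longrightarrow> (\<Sum>(s, t)\<in>C. \<bar>t - s\<bar>) < \<delta> \<Longrightarrow>
      (\<Sum>(s, t)\<in>C. oscillation F s t) < ereal \<epsilon>"
proof -
  from assms obtain \<delta> where \<delta>: "0 < \<delta>" "\<forall>C. finite C \<longrightarrow> (\<forall>(s, t)\<in>C. s \<in> E \<and> t \<in> E \<and> s < t) \<longrightarrow>
      disjoint_family_on (\<lambda>(s, t). {s<..<t}) C \<longrightarrow> (\<Sum>(s, t)\<in>C. \<bar>t - s\<bar>) < \<delta> \<longrightarrow>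
      (\<Sum>(s, t)\<in>C. oscillation F s t) < ereal \<epsilon>"
    unfolding AC_star_def by blast
  show thesis by (rule that[of \<delta>]) (use \<delta> in simp_all)
qed

text \<open>The supremum of the sums of oscillations over families with endpoints in \<open>E\<close> up to \<open>x\<close> is the
  function \<open>W\<close> of the preceding lemma: appending an interval \<open>(x, y)\<close> to a family that ends
  before \<open>x\<close> adds the oscillation over it.\<close>

lemma ae_differentiable_if_bounded_variation:
  fixes F :: "real \<Rightarrow> real"
  assumes E: "E \<subseteq> {a<..<b}"
    and var: "\<And>C. finite C \<Longrightarrow> \<forall>(s, t)\<in>C. s \<in> E \<and> t \<in> E \<and> s < t \<Longrightarrow>
      disjoint_family_on (\<lambda>(s, t). {s<..<t}) C \<Longrightarrow> (\<Sum>(s, t)\<in>C. oscillation F s t) \<le> ereal B"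
  shows "negligible {x \<in> E. \<not> F differentiable (at x)}"
proof -
  define fam where "fam x = {C. finite C \<and> (\<forall>(s, t)\<in>C. s \<in> E \<and> t \<in> E \<and> s < t \<and> t \<le> x) \<and>
    disjoint_family_on (\<lambda>(s, t). {s<..<t}) C}" for x
  define V where "V C = (\<Sum>(s, t)\<in>C. real_of_ereal (oscillation F s t))" for C
  have osc: "ereal (real_of_ereal (oscillation F s t)) = oscillation F s t"
    if "s \<in> E" "t \<in> E" "s < t" for s t
  proof -
    have "(\<Sum>(s, t)\<in>{(s, t)}. oscillation F s t) \<le> ereal B"
      using that by (intro var) (auto simp: disjoint_family_on_def)
    then show ?thesis
      using oscillation_nonneg[of s t F] that by (intro ereal_real') auto
  qed
  have V_le: "V C \<le> B" if "C \<in> fam x" for C x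
  proof -
    have "ereal (V C) = (\<Sum>i\<in>C. ereal (case i of (s, t) \<Rightarrow> real_of_ereal (oscillation F s t)))"
      unfolding V_def by (rule sum_ereal[symmetric])
    also have "\<dots> = (\<Sum>(s, t)\<in>C. oscillation F s t)"
      using that osc by (intro sum.cong) (auto simp: fam_def)
    also have "\<dots> \<le> ereal B" using that by (intro var) (auto simp: fam_def)
    finally show ?thesis by simp
  qed
  define W where "W x = Sup (V ` fam x)" for x
  have bdd: "bdd_above (V ` fam x)" for x using V_le by (intro bdd_aboveI[of _ B]) blast
  have empty: "{} \<in> fam x" for x by (simp add: fam_def disjoint_family_on_def)
  show ?thesis
  proof (rule ae_differentiable_if_controlled[OF E])
    show "mono W"
    proof (rule monoI)
      fix x y :: real assume "x \<le> y"
      then have "fam x \<subseteq> fam y" unfolding fam_def by force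
      then show "W x \<le> W y" unfolding W_def using empty by (intro cSup_subset_mono bdd) auto
    qed
    fix x y p assume xy: "x \<in> E" "y \<in> E" "x \<le> p" "p \<le> y"
    show "\<bar>F p - F x\<bar> \<le> W y - W x"
    proof (cases "x = y")
      case False
      then have "x < y" using xy by simp
      have "V C \<le> W y - real_of_ereal (oscillation F x y)" if C: "C \<in> fam x" for C
      proof -
        have le: "t \<le> x" if "(s, t) \<in> C" for s t using that C by (auto simp: fam_def)
        then have new: "(x, y) \<notin> C" using \<open>x < y\<close> by force
        have "(case i of (s, t) \<Rightarrow> {s<..<t}) \<inter> {x<..<y} = {}" if "i \<in> C" for i
          using le[of "fst i" "snd i"] that by (cases i) auto
        moreover have "disjoint_family_on (\<lambda>(s, t). {s<..<t}) C" using C by (simp add: fam_def)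
        ultimately have "disjoint_family_on (\<lambda>(s, t). {s<..<t}) (insert (x, y) C)"
          using new by (subst disjoint_family_on_insert) auto
        moreover have "\<forall>(s, t)\<in>C. s \<in> E \<and> t \<in> E \<and> s < t \<and> t \<le> y"
          using C \<open>x < y\<close> by (force simp: fam_def)
        ultimately have "insert (x, y) C \<in> fam y"
          using C xy \<open>x < y\<close> by (simp add: fam_def)
        then have "V (insert (x, y) C) \<le> W y" unfolding W_def by (intro cSup_upper bdd) auto
        moreover have "V (insert (x, y) C) = real_of_ereal (oscillation F x y) + V C"
          using C new by (simp add: V_def fam_def)
        ultimately show ?thesis by linarith
      qed
      then have "W x \<le> W y - real_of_ereal (oscillation F x y)"
        unfolding W_def[of x] using empty by (intro cSup_least) auto
      moreover have "ereal \<bar>F x - F p\<bar> \<le> ereal (real_of_ereal (oscillation F x y))"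
        unfolding osc[OF xy(1,2) \<open>x < y\<close>] using xy by (intro oscillation_ge) auto
      ultimately show ?thesis by (simp add: abs_minus_commute)
    qed (use xy in simp)
  qed
qed

text \<open>If \<open>E\<close> is cut into cells shorter than the \<open>\<delta>\<close> that belongs to \<open>\<epsilon> = 1\<close>, every family
  within one cell is short enough, so on each cell the sums of oscillations are bounded by \<open>1\<close>.\<close>

lemma AC_star_imp_ae_differentiable:
  assumes "AC_star F E"
  shows "negligible {x \<in> E. \<not> F differentiable (at x)}"
proof -
  obtain \<delta> where \<delta>: "0 < \<delta>" "\<And>C. finite C \<Longrightarrow> \<forall>(s, t)\<in>C. s \<in> E \<and> t \<in> E \<and> s < t \<Longrightarrow>
      disjoint_family_on (\<lambda>(s, t). {s<..<t}) C \<Longrightarrow> (\<Sum>(s, t)\<in>C. \<bar>t - s\<bar>) < \<delta> \<Longrightarrow>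
      (\<Sum>(s, t)\<in>C. oscillation F s t) < ereal 1"
    by (rule AC_starE[OF assms zero_less_one]) (rule that)
  define h where "h = \<delta> / 2"
  have "0 < h" "h < \<delta>" using \<delta>(1) by (auto simp: h_def)
  define cell where "cell k = E \<inter> {of_int k * h..<(of_int k + 1) * h}" for k :: int
  have "negligible {x \<in> cell k. \<not> F differentiable (at x)}" for k
  proof (rule ae_differentiable_if_bounded_variation)
    show "cell k \<subseteq> {of_int k * h - 1<..<(of_int k + 1) * h}" by (auto simp: cell_def)
    fix C :: "(real \<times> real) set"
    assume C: "finite C" "\<forall>(s, t)\<in>C. s \<in> cell k \<and> t \<in> cell k \<and> s < t"
      "disjoint_family_on (\<lambda>(s, t). {s<..<t}) C"
    have "(\<Sum>(s, t)\<in>C. \<bar>t - s\<bar>) = (\<Sum>(s, t)\<in>C. t - s)"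
      using C(2) by (intro sum.cong) auto
    also have "\<dots> \<le> (of_int k + 1) * h - of_int k * h"
    proof (rule sum_increments_le[of "\<lambda>x. x"])
      show "of_int k * h \<le> (of_int k + 1) * h" using \<open>0 < h\<close> by (simp add: algebra_simps)
      show "of_int k * h \<le> u \<and> u < v \<and> v \<le> (of_int k + 1) * h" if "(u, v) \<in> C" for u v
        using C(2) that by (fastforce simp: cell_def)
    qed (use C in \<open>auto simp: mono_def\<close>)
    also have "\<dots> < \<delta>" using \<open>h < \<delta>\<close> by (simp add: algebra_simps)
    finally have "(\<Sum>(s, t)\<in>C. oscillation F s t) < ereal 1"
      using C by (intro \<delta>(2)) (auto simp: cell_def)
    then show "(\<Sum>(s, t)\<in>C. oscillation F s t) \<le> ereal 1" by (rule less_imp_le)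
  qed
  then have "negligible (\<Union>k. {x \<in> cell k. \<not> F differentiable (at x)})"
    by (intro negligible_countable_Union) auto
  then show ?thesis
  proof (rule negligible_subset, intro subsetI)
    fix x assume x: "x \<in> {x \<in> E. \<not> F differentiable (at x)}"
    have "of_int \<lfloor>x / h\<rfloor> * h \<le> x" "x < (of_int \<lfloor>x / h\<rfloor> + 1) * h"
      using \<open>0 < h\<close> floor_divide_lower floor_divide_upper by auto
    then show "x \<in> (\<Union>k. {x \<in> cell k. \<not> F differentiable (at x)})"
      using x by (auto simp: cell_def)
  qed
qed

theorem ACG_star_imp_ae_differentiable:
  assumes "ACG_star F"
  shows "negligible {x. \<not> F differentiable (at x)}"
proof -
  obtain E :: "nat \<Rightarrow> real set" where E: "(\<Union>n. E n) = UNIV" "\<And>n. AC_star F (E n)"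
    using assms unfolding ACG_star_def by blast
  have "negligible (\<Union>n. {x \<in> E n. \<not> F differentiable (at x)})"
    using AC_star_imp_ae_differentiable[OF E(2)] by (intro negligible_countable_Union) auto
  then show ?thesis by (rule negligible_subset) (use E(1) in blast)
qed

section \<open>Variation on null sets\<close>

text \<open>The intervals \<open>[x, v x]\<close> do not overlap: each tag \<open>x\<close> is the left end of its interval, and the
  interval stops before the next tag. Splitting at the tags makes a tagged division into a family
  of this kind and the mirror image of another one, so that one-sided estimates suffice.\<close>

definition right_increments_le ::
    "(real \<Rightarrow> 'a::real_normed_vector) \<Rightarrow> real set \<Rightarrow> (real \<Rightarrow> real) \<Rightarrow> real \<Rightarrow> bool" where
  "right_increments_le F N \<delta> \<epsilon> \<longleftrightarrow>
    (\<forall>T v. finite T \<longrightarrow> T \<subseteq> N \<longrightarrow> (\<forall>x\<in>T. x < v x \<and> v x < x + \<delta> x) \<longrightarrow>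
      (\<forall>x\<in>T. \<forall>y\<in>T. x < y \<longrightarrow> v x \<le> y) \<longrightarrow> (\<Sum>x\<in>T. norm (F (v x) - F x)) \<le> \<epsilon>)"

text \<open>The strong Lusin condition, restricted to increments to the right. The fineness \<open>\<delta>\<close> may depend on
  the tag, as for gauges.\<close>

definition null_variation_right :: "(real \<Rightarrow> 'a::real_normed_vector) \<Rightarrow> real set \<Rightarrow> bool" where
  "null_variation_right F N \<longleftrightarrow> (\<forall>\<epsilon>>0. \<exists>\<delta>. (\<forall>x. 0 < \<delta> x) \<and> right_increments_le F N \<delta> \<epsilon>)"

lemma right_increments_leI:
  assumes "\<And>T v. finite T \<Longrightarrow> T \<subseteq> N \<Longrightarrow> \<forall>x\<in>T. x < v x \<and> v x < x + \<delta> x \<Longrightarrow>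
    \<forall>x\<in>T. \<forall>y\<in>T. x < y \<longrightarrow> v x \<le> y \<Longrightarrow> (\<Sum>x\<in>T. norm (F (v x) - F x)) \<le> \<epsilon>"
  shows "right_increments_le F N \<delta> \<epsilon>"
  unfolding right_increments_le_def using assms by simp

lemma right_increments_leD:
  assumes "right_increments_le F N \<delta> \<epsilon>" "finite T" "T \<subseteq> N" "\<forall>x\<in>T. x < v x \<and> v x < x + \<delta> x"
    "\<forall>x\<in>T. \<forall>y\<in>T. x < y \<longrightarrow> v x \<le> y"
  shows "(\<Sum>x\<in>T. norm (F (v x) - F x)) \<le> \<epsilon>"
  using assms unfolding right_increments_le_def by simp

lemma null_variation_rightI:
  assumes "\<And>\<epsilon>. 0 < \<epsilon> \<Longrightarrow> \<exists>\<delta>. (\<forall>x. 0 < \<delta> x) \<and> right_increments_le F N \<delta> \<epsilon>"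
  shows "null_variation_right F N"
  using assms unfolding null_variation_right_def by blast

lemma null_variation_rightE:
  assumes "null_variation_right F N" "0 < \<epsilon>"
  obtains \<delta> where "\<And>x. 0 < \<delta> x" "right_increments_le F N \<delta> \<epsilon>"
  using assms unfolding null_variation_right_def by blast

lemma null_variation_right_subset:
  assumes N: "null_variation_right F N" and "M \<subseteq> N"
  shows "null_variation_right F M"
proof (rule null_variation_rightI)
  fix \<epsilon> :: real assume "0 < \<epsilon>"
  then obtain \<delta> where \<delta>: "\<And>x. 0 < \<delta> x" "right_increments_le F N \<delta> \<epsilon>"
    using null_variation_rightE[OF N] by blast
  have "right_increments_le F M \<delta> \<epsilon>"
    by (rule right_increments_leI, rule right_increments_leD[OF \<delta>(2)])
      (use \<open>M \<subseteq> N\<close> in \<open>auto dest: order_trans\<close>)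
  then show "\<exists>\<delta>. (\<forall>x. 0 < \<delta> x) \<and> right_increments_le F M \<delta> \<epsilon>" using \<delta>(1) by blast
qed

text \<open>Each tag uses the fineness of the first set that contains it, with the tolerances
  \<open>\<epsilon> / 2, \<epsilon> / 4, \<epsilon> / 8, \<dots>\<close> adding up to \<open>\<epsilon>\<close>.\<close>

lemma null_variation_right_UN:
  fixes N :: "nat \<Rightarrow> real set"
  assumes "\<And>n. null_variation_right F (N n)"
  shows "null_variation_right F (\<Union>n. N n)"
proof (rule null_variation_rightI)
  fix \<epsilon> :: real assume "0 < \<epsilon>"
  have "\<forall>n. \<exists>\<delta>. (\<forall>x. 0 < \<delta> x) \<and> right_increments_le F (N n) \<delta> (\<epsilon> * (1 / 2) ^ Suc n)"
    using assms \<open>0 < \<epsilon>\<close> unfolding null_variation_right_def by simp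
  from choice[OF this] obtain \<delta> where \<delta>: "\<And>n x. 0 < \<delta> n x"
    "\<And>n. right_increments_le F (N n) (\<delta> n) (\<epsilon> * (1 / 2) ^ Suc n)"
    by blast
  define idx where "idx x = (LEAST n. x \<in> N n)" for x
  have idx: "x \<in> N (idx x)" if "x \<in> (\<Union>n. N n)" for x
    using that unfolding idx_def by (auto intro: LeastI)
  have "(\<Sum>x\<in>T. norm (F (v x) - F x)) \<le> \<epsilon>"
    if T: "finite T" "T \<subseteq> (\<Union>n. N n)" "\<forall>x\<in>T. x < v x \<and> v x < x + \<delta> (idx x) x"
      "\<forall>x\<in>T. \<forall>y\<in>T. x < y \<longrightarrow> v x \<le> y" for T v
  proof -
    have "(\<Sum>x\<in>T. norm (F (v x) - F x)) =
        (\<Sum>n\<in>idx ` T. \<Sum>x\<in>{x \<in> T. idx x = n}. norm (F (v x) - F x))"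
      by (rule sum.image_gen[OF T(1)])
    also have "\<dots> \<le> (\<Sum>n\<in>idx ` T. \<epsilon> * (1 / 2) ^ Suc n)"
    proof (intro sum_mono right_increments_leD[OF \<delta>(2)])
      fix n
      show "{x \<in> T. idx x = n} \<subseteq> N n" using T(2) idx by blast
    qed (use T in auto)
    also have "\<dots> = \<epsilon> * (\<Sum>n\<in>idx ` T. (1 / 2) ^ Suc n)" by (simp add: sum_distrib_left)
    also have "\<dots> \<le> \<epsilon> * 1"
    proof (rule mult_left_mono)
      show "(\<Sum>n\<in>idx ` T. (1 / 2 :: real) ^ Suc n) \<le> 1"
        using sum_le_suminf[OF sums_summable[OF power_half_series], of "idx ` T"]
          sums_unique[OF power_half_series] T(1) by simp
    qed (use \<open>0 < \<epsilon>\<close> in simp)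
    finally show ?thesis by simp
  qed
  then have "right_increments_le F (\<Union>n. N n) (\<lambda>x. \<delta> (idx x) x) \<epsilon>"
    by (rule right_increments_leI)
  then show "\<exists>\<delta>. (\<forall>x. 0 < \<delta> x) \<and> right_increments_le F (\<Union>n. N n) \<delta> \<epsilon>"
    using \<delta>(1) by (intro exI[of _ "\<lambda>x. \<delta> (idx x) x"]) simp
qed

lemma null_variation_right_Un:
  assumes "null_variation_right F M" "null_variation_right F N"
  shows "null_variation_right F (M \<union> N)"
proof -
  have "null_variation_right F (\<Union>n. if n = (0::nat) then M else N)"
    using assms by (intro null_variation_right_UN) auto
  then show ?thesis by (rule null_variation_right_subset) (auto split: if_splits)
qed

text \<open>At a single tag only one interval starts, and continuity makes its increment small.\<close>

lemma null_variation_right_countable: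
  assumes F: "continuous_on UNIV F" and "countable N"
  shows "null_variation_right F N"
proof (cases "N = {}")
  case True
  have "null_variation_right F {}"
    unfolding null_variation_right_def right_increments_le_def by (auto intro: exI[of _ "\<lambda>_. 1"])
  then show ?thesis using True by simp
next
  case False
  have "null_variation_right F {c}" for c
  proof (rule null_variation_rightI)
    fix \<epsilon> :: real assume "0 < \<epsilon>"
    then obtain d where d: "0 < d" "\<And>y. dist y c < d \<Longrightarrow> dist (F y) (F c) < \<epsilon>"
      using F unfolding continuous_on_iff by (metis UNIV_I)
    have "(\<Sum>x\<in>T. norm (F (v x) - F x)) \<le> \<epsilon>" if "T \<subseteq> {c}" "\<forall>x\<in>T. x < v x \<and> v x < x + d" for T v
    proof -
      consider "T = {}" | "T = {c}" using \<open>T \<subseteq> {c}\<close> by blast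
      then show ?thesis
      proof cases
        case 2
        then have "dist (v c) c < d" using that(2) by (simp add: dist_real_def)
        from d(2)[OF this] show ?thesis using 2 by (simp add: dist_norm)
      qed (use \<open>0 < \<epsilon>\<close> in simp)
    qed
    then have "right_increments_le F {c} (\<lambda>_. d) \<epsilon>"
      by (intro right_increments_leI)
    then show "\<exists>\<delta>. (\<forall>x. 0 < \<delta> x) \<and> right_increments_le F {c} \<delta> \<epsilon>"
      using d(1) by (intro exI[of _ "\<lambda>_. d"]) simp
  qed
  then have "null_variation_right F (\<Union>n. {from_nat_into N n})"
    by (intro null_variation_right_UN)
  then show ?thesis
    by (rule null_variation_right_subset) (use range_from_nat_into[OF False \<open>countable N\<close>] in blast)
qed

text \<open>The right ends \<open>v x\<close> need not lie in \<open>E\<close>, whereas \<open>AC\<^sub>*\<close> speaks of intervals with both ends in \<open>E\<close>.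
  Choose for each \<open>x \<in> N\<close> a point \<open>e x \<in> E\<close> to its right, so close that \<open>[x, e x]\<close> lies in an open
  set \<open>U\<close> of small measure around \<open>N\<close>. Extend \<open>[x, v x]\<close> to the smaller of \<open>e x\<close> and the next tag:
  both belong to \<open>E\<close>, and the extended intervals still do not overlap and lie in \<open>U\<close>, so their total
  length is small. The oscillation over the extended interval bounds the increment over the
  original one.\<close>

lemma AC_star_imp_null_variation_right:
  assumes "AC_star F E" "negligible N" "N \<subseteq> E"
    and acc: "\<And>x \<eta>. x \<in> N \<Longrightarrow> 0 < \<eta> \<Longrightarrow> \<exists>e\<in>E. x < e \<and> e < x + \<eta>"
  shows "null_variation_right F N"
proof (rule null_variation_rightI)
  fix \<epsilon> :: real assume "0 < \<epsilon>"
  then obtain d where d: "0 < d" "\<And>C. finite C \<Longrightarrow> \<forall>(s, t)\<in>C. s \<in> E \<and> t \<in> E \<and> s < t \<Longrightarrow>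
      disjoint_family_on (\<lambda>(s, t). {s<..<t}) C \<Longrightarrow> (\<Sum>(s, t)\<in>C. \<bar>t - s\<bar>) < d \<Longrightarrow>
      (\<Sum>(s, t)\<in>C. oscillation F s t) < ereal \<epsilon>"
    by (rule AC_starE[OF assms(1)]) (rule that)
  obtain U where U: "open U" "N \<subseteq> U" "U \<in> lmeasurable" "measure lebesgue U < d"
    using negligible_outer_open[OF assms(2) d(1)] by blast
  have "\<exists>e. e \<in> E \<and> x < e \<and> {x..e} \<subseteq> U" if x: "x \<in> N" for x
  proof -
    have "x \<in> U" using x U(2) by blast
    then obtain r where r: "0 < r" "ball x r \<subseteq> U" using U(1) openE by blast
    obtain e where "e \<in> E" "x < e" "e < x + r" using acc[OF x r(1)] by blast
    moreover from this have "{x..e} \<subseteq> ball x r" by (auto simp: dist_real_def)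
    ultimately show ?thesis using r(2) by blast
  qed
  then obtain e where e: "\<And>x. x \<in> N \<Longrightarrow> e x \<in> E" "\<And>x. x \<in> N \<Longrightarrow> x < e x" "\<And>x. x \<in> N \<Longrightarrow> {x..e x} \<subseteq> U"
    by metis
  define \<delta> where "\<delta> x = (if x \<in> N then e x - x else 1)" for x
  have "(\<Sum>x\<in>T. norm (F (v x) - F x)) \<le> \<epsilon>"
    if T: "finite T" "T \<subseteq> N" "\<forall>x\<in>T. x < v x \<and> v x < x + \<delta> x"
      "\<forall>x\<in>T. \<forall>y\<in>T. x < y \<longrightarrow> v x \<le> y" for T v
  proof -
    define nxt where "nxt x = Min (insert (e x) {y \<in> T. x < y})" for x
    have fin: "finite (insert (e x) {y \<in> T. x < y})" for x using T(1) by simp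
    have nxt: "nxt x \<in> E" "x < nxt x" "nxt x \<le> e x" "v x \<le> nxt x" "\<And>y. y \<in> T \<Longrightarrow> x < y \<Longrightarrow> nxt x \<le> y"
      if x: "x \<in> T" for x
    proof -
      have "nxt x \<in> insert (e x) {y \<in> T. x < y}" unfolding nxt_def using fin by (intro Min_in) auto
      moreover have "x \<in> N" using x T(2) by blast
      moreover have "v x \<le> e x" using T(3) x \<open>x \<in> N\<close> by (auto simp: \<delta>_def)
      ultimately show "nxt x \<in> E" "x < nxt x" "v x \<le> nxt x"
        using T assms(3) e x by auto
      show "nxt x \<le> e x" "\<And>y. y \<in> T \<Longrightarrow> x < y \<Longrightarrow> nxt x \<le> y"
        unfolding nxt_def using fin by (auto intro!: Min_le)
    qed
    define C where "C = (\<lambda>x. (x, nxt x)) ` T"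
    have inj: "inj_on (\<lambda>x. (x, nxt x)) T" by (auto simp: inj_on_def)
    have disj: "disjoint_family_on (\<lambda>x. {x<..<nxt x}) T"
      unfolding disjoint_family_on_def
    proof (intro ballI impI)
      fix x y assume "x \<in> T" "y \<in> T" "x \<noteq> y"
      then show "{x<..<nxt x} \<inter> {y<..<nxt y} = {}"
        using nxt(5)[of x y] nxt(5)[of y x] by (cases "x < y") auto
    qed
    have "(\<Sum>(s, t)\<in>C. oscillation F s t) < ereal \<epsilon>"
    proof (rule d(2))
      show "finite C" using T(1) by (simp add: C_def)
      show "\<forall>(s, t)\<in>C. s \<in> E \<and> t \<in> E \<and> s < t"
        using nxt T(2) assms(3) by (auto simp: C_def)
      show "disjoint_family_on (\<lambda>(s, t). {s<..<t}) C"
        using disj by (auto simp: C_def disjoint_family_on_def)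
      have "(\<Sum>(s, t)\<in>C. \<bar>t - s\<bar>) = (\<Sum>x\<in>T. measure lebesgue {x<..<nxt x})"
        unfolding C_def sum.reindex[OF inj] using nxt(2) by (intro sum.cong) (auto simp: less_imp_le)
      also have "\<dots> = measure lebesgue (\<Union>x\<in>T. {x<..<nxt x})"
        using T(1) disj by (intro measure_UNION'[symmetric]) (auto simp: pairwise_def disjnt_def disjoint_family_on_def)
      also have "\<dots> \<le> measure lebesgue U"
      proof (rule measure_mono_fmeasurable)
        show "(\<Union>x\<in>T. {x<..<nxt x}) \<subseteq> U"
        proof
          fix z assume "z \<in> (\<Union>x\<in>T. {x<..<nxt x})"
          then obtain x where x: "x \<in> T" "x < z" "z < nxt x" by auto
          then have "z \<in> {x..e x}" using nxt(3)[of x] by simp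
          then show "z \<in> U" using e(3)[of x] x(1) T(2) by blast
        qed
        show "(\<Union>x\<in>T. {x<..<nxt x}) \<in> sets lebesgue" using T(1) by auto
      qed (rule U(3))
      finally show "(\<Sum>(s, t)\<in>C. \<bar>t - s\<bar>) < d" using U(4) by simp
    qed
    moreover have "ereal (\<Sum>x\<in>T. norm (F (v x) - F x)) \<le> (\<Sum>(s, t)\<in>C. oscillation F s t)"
    proof -
      have "ereal (\<Sum>x\<in>T. norm (F (v x) - F x)) = (\<Sum>x\<in>T. ereal \<bar>F x - F (v x)\<bar>)"
        by (simp add: abs_minus_commute)
      also have "\<dots> \<le> (\<Sum>x\<in>T. oscillation F x (nxt x))"
        using nxt(4) T(3) by (intro sum_mono oscillation_ge) (auto simp: less_imp_le)
      finally show ?thesis unfolding C_def sum.reindex[OF inj] by simp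
    qed
    ultimately have "ereal (\<Sum>x\<in>T. norm (F (v x) - F x)) < ereal \<epsilon>" by (rule order_le_less_trans[rotated])
    then show ?thesis by simp
  qed
  then have "right_increments_le F N \<delta> \<epsilon>" by (rule right_increments_leI)
  moreover have "\<forall>x. 0 < \<delta> x" using e(2) by (simp add: \<delta>_def)
  ultimately show "\<exists>\<delta>. (\<forall>x. 0 < \<delta> x) \<and> right_increments_le F N \<delta> \<epsilon>" by blast
qed

text \<open>In each of the countably many \<open>AC\<^sub>*\<close> pieces, the tags without points of the piece directly to their
  right are countably many, and continuity takes care of them.\<close>

lemma ACG_star_imp_null_variation_right:
  assumes "ACG_star F" "negligible N"
  shows "null_variation_right F N"
proof -
  have cont: "continuous_on UNIV F" using assms(1) by (simp add: ACG_star_def)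
  obtain E :: "nat \<Rightarrow> real set" where E: "(\<Union>n. E n) = UNIV" "\<And>n. AC_star F (E n)"
    using assms(1) unfolding ACG_star_def by blast
  let ?R = "\<lambda>n. {x \<in> E n. \<exists>\<eta>>0. {x<..<x + \<eta>} \<inter> E n = {}}"
  have "null_variation_right F ((N \<inter> E n - ?R n) \<union> ?R n)" for n
  proof (rule null_variation_right_Un)
    show "null_variation_right F (N \<inter> E n - ?R n)"
    proof (rule AC_star_imp_null_variation_right[OF E(2)])
      show "negligible (N \<inter> E n - ?R n)" by (rule negligible_subset[OF assms(2)]) blast
      show "\<exists>e\<in>E n. x < e \<and> e < x + \<eta>" if "x \<in> N \<inter> E n - ?R n" "0 < \<eta>" for x \<eta>
        using that by fastforce
    qed blast
    show "null_variation_right F (?R n)"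
      by (rule null_variation_right_countable[OF cont countable_right_isolated])
  qed
  then have "null_variation_right F (\<Union>n. (N \<inter> E n - ?R n) \<union> ?R n)"
    by (rule null_variation_right_UN)
  then show ?thesis by (rule null_variation_right_subset) (use E(1) in blast)
qed

lemma disjoint_family_on_image:
  "disjoint_family_on (\<lambda>i. A (f i)) I \<Longrightarrow> disjoint_family_on A (f ` I)"
  unfolding disjoint_family_on_def by (metis imageE)

section \<open>A fundamental theorem of calculus\<close>

text \<open>The same bound for indexed families, as they arise from divisions: intervals of length zero and
  intervals that end at their tag contribute nothing, and among the others the tag determines the
  interval because interiors are disjoint.\<close>

lemma sum_right_increments_le:
  assumes F: "right_increments_le F N \<delta> \<epsilon>" and "finite I"
    and I: "\<And>i. i \<in> I \<Longrightarrow> u i \<le> x i \<and> x i \<le> v i \<and> v i < x i + \<delta> (x i) \<and> x i \<in> N"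
    and disj: "disjoint_family_on (\<lambda>i. {u i<..<v i}) I"
  shows "(\<Sum>i\<in>I. norm (F (v i) - F (x i))) \<le> \<epsilon>"
proof -
  define J where "J = {i \<in> I. x i < v i}"
  have ord: "v i \<le> x j" if "i \<in> J" "j \<in> J" "i \<noteq> j" "x i \<le> x j" for i j
  proof (rule ccontr)
    assume "\<not> v i \<le> x j"
    then have "x j < min (v i) (v j)" using that by (simp add: J_def)
    then obtain z where "x j < z" "z < min (v i) (v j)" using dense by blast
    moreover have "u i \<le> x i" "u j \<le> x j" using I that by (auto simp: J_def)
    ultimately have "z \<in> {u i<..<v i} \<inter> {u j<..<v j}" using that(4) by simp
    then show False
      using disjoint_family_onD[OF disj, of i j] that by (auto simp: J_def)
  qed
  have inj: "inj_on x J"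
  proof (rule inj_onI, rule ccontr)
    fix i j assume "i \<in> J" "j \<in> J" "x i = x j" "i \<noteq> j"
    then show False using ord[of i j] by (auto simp: J_def)
  qed
  define w where "w = (\<lambda>y. v (the_inv_into J x y))"
  have w: "w (x i) = v i" if "i \<in> J" for i
    using the_inv_into_f_f[OF inj that] by (simp add: w_def)
  have "(\<Sum>i\<in>I. norm (F (v i) - F (x i))) = (\<Sum>i\<in>J. norm (F (v i) - F (x i)))"
  proof (rule sum.mono_neutral_right)
    show "\<forall>i\<in>I - J. norm (F (v i) - F (x i)) = 0"
    proof
      fix i assume "i \<in> I - J"
      then have "x i = v i" using I[of i] by (auto simp: J_def)
      then show "norm (F (v i) - F (x i)) = 0" by simp
    qed
  qed (use \<open>finite I\<close> in \<open>auto simp: J_def\<close>)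
  also have "\<dots> = (\<Sum>y\<in>x ` J. norm (F (w y) - F y))"
    unfolding sum.reindex[OF inj] using w by (intro sum.cong) auto
  also have "\<dots> \<le> \<epsilon>"
  proof (rule right_increments_leD[OF F])
    show "\<forall>y\<in>x ` J. y < w y \<and> w y < y + \<delta> y" using w I by (auto simp: J_def)
    show "\<forall>y\<in>x ` J. \<forall>z\<in>x ` J. y < z \<longrightarrow> w y \<le> z" using w ord by force
  qed (use \<open>finite I\<close> I in \<open>auto simp: J_def\<close>)
  finally show ?thesis .
qed

text \<open>Compare the Riemann sum with the telescoping sum of the increments of \<open>F\<close>, interval by interval.
  For tags off \<open>N\<close> the derivative controls the difference. For tags in \<open>N\<close> the integrand may be taken
  to be \<open>0\<close>, and the increments of \<open>F\<close> to both sides of the tags have a small total.\<close>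

theorem fundamental_theorem_of_calculus_null_variation:
  fixes F :: "real \<Rightarrow> 'a::banach"
  assumes "a \<le> b" and N: "negligible N"
    and deriv: "\<And>x. x \<notin> N \<Longrightarrow> (F has_vector_derivative g x) (at x)"
    and right: "null_variation_right F N"
    and left: "null_variation_right (\<lambda>x. F (- x)) (uminus ` N)"
  shows "(g has_integral (F b - F a)) {a..b}"
proof -
  define h where "h x = (if x \<in> N then 0 else g x)" for x
  have "(h has_integral (F b - F a)) (cbox a b)"
    unfolding has_integral
  proof (intro allI impI)
    fix \<epsilon> :: real assume "0 < \<epsilon>"
    \<comment> \<open>Adding 1 covers the case \<open>a = b\<close>.\<close>
    define c where "c = b - a + 1"
    have "0 < c" using \<open>a \<le> b\<close> by (simp add: c_def)
    define \<eta> where "\<eta> = \<epsilon> / 4 / c"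
    have "0 < \<eta>" using \<open>0 < \<epsilon>\<close> \<open>0 < c\<close> by (simp add: \<eta>_def)
    have "\<forall>x. \<exists>d>0. x \<notin> N \<longrightarrow>
        (\<forall>y. \<bar>y - x\<bar> < d \<longrightarrow> norm (F y - F x - (y - x) *\<^sub>R g x) \<le> \<eta> * \<bar>y - x\<bar>)"
      using deriv \<open>0 < \<eta>\<close> unfolding has_vector_derivative_def has_derivative_at_alt real_norm_def
      by (meson zero_less_one)
    from choice[OF this] obtain d where d: "\<And>x. 0 < d x"
      "\<And>x y. x \<notin> N \<Longrightarrow> \<bar>y - x\<bar> < d x \<Longrightarrow> norm (F y - F x - (y - x) *\<^sub>R g x) \<le> \<eta> * \<bar>y - x\<bar>"
      by blast
    obtain \<delta> where \<delta>: "\<And>x. 0 < \<delta> x" "right_increments_le F N \<delta> (\<epsilon> / 4)"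
      using null_variation_rightE[OF right, of "\<epsilon> / 4"] \<open>0 < \<epsilon>\<close> by auto
    obtain \<delta>' where \<delta>': "\<And>x. 0 < \<delta>' x" "right_increments_le (\<lambda>x. F (- x)) (uminus ` N) \<delta>' (\<epsilon> / 4)"
      using null_variation_rightE[OF left, of "\<epsilon> / 4"] \<open>0 < \<epsilon>\<close> by auto
    define r where "r x = min (d x) (min (\<delta> x) (\<delta>' (- x)))" for x
    have "gauge (\<lambda>x. ball x (r x))"
      using d(1) \<delta>(1) \<delta>'(1) by (intro gauge_ball_dependent) (simp add: r_def)
    moreover have "norm ((\<Sum>(x, K)\<in>p. Henstock_Kurzweil_Integration.content K *\<^sub>R h x) - (F b - F a)) < \<epsilon>"
      if p: "p tagged_division_of cbox a b" and fine: "(\<lambda>x. ball x (r x)) fine p" for p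
    proof -
      have finp: "finite p" using p by blast
      have K: "K = {Inf K..Sup K}" "Inf K \<le> x" "x \<le> Sup K" "x - r x < Inf K" "Sup K < x + r x"
        if xK: "(x, K) \<in> p" for x K
      proof -
        obtain s t where st: "K = cbox s t" using tagged_division_ofD(4)[OF p xK] by blast
        have "x \<in> K" using tagged_division_ofD(2)[OF p xK] .
        then have "s \<le> t" "s \<le> x" "x \<le> t" using st by auto
        then have eq: "Inf K = s" "Sup K = t" using st by auto
        have "s \<in> ball x (r x)" "t \<in> ball x (r x)"
          using fine xK st \<open>s \<le> t\<close> unfolding fine_def by fastforce+
        then show "K = {Inf K..Sup K}" "Inf K \<le> x" "x \<le> Sup K" "x - r x < Inf K" "Sup K < x + r x"
          using eq st \<open>s \<le> x\<close> \<open>x \<le> t\<close> by (auto simp: dist_real_def)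
      qed
      have ba: "b - a = (\<Sum>(x, K)\<in>p. Sup K - Inf K)" "F b - F a = (\<Sum>(x, K)\<in>p. F (Sup K) - F (Inf K))"
        using additive_tagged_division_1[OF \<open>a \<le> b\<close>, of p "\<lambda>x. x"]
          additive_tagged_division_1[OF \<open>a \<le> b\<close>, of p F] p by auto
      define q where "q = {i \<in> p. fst i \<in> N}"
      have q: "q \<subseteq> p" "finite q" "finite (p - q)" using finp by (auto simp: q_def)
      let ?t = "\<lambda>i. Henstock_Kurzweil_Integration.content (snd i) *\<^sub>R h (fst i) - (F (Sup (snd i)) - F (Inf (snd i)))"
      have disj: "disjoint_family_on (\<lambda>i. {Inf (snd i)<..<Sup (snd i)}) q"
        unfolding disjoint_family_on_def
      proof (intro ballI impI)
        fix i j assume "i \<in> q" "j \<in> q" "i \<noteq> j"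
        then have "interior (snd i) \<inter> interior (snd j) = {}"
          using q(1) tagged_division_ofD(5)[OF p, of "fst i" "snd i" "fst j" "snd j"] by auto
        moreover have "interior (snd i) = {Inf (snd i)<..<Sup (snd i)}" if "i \<in> q" for i
          using K(1)[of "fst i" "snd i"] that q(1) interior_atLeastAtMost_real by (metis prod.collapse subsetD)
        ultimately show "{Inf (snd i)<..<Sup (snd i)} \<inter> {Inf (snd j)<..<Sup (snd j)} = {}"
          using \<open>i \<in> q\<close> \<open>j \<in> q\<close> by simp
      qed
      have sR: "(\<Sum>i\<in>q. norm (F (Sup (snd i)) - F (fst i))) \<le> \<epsilon> / 4"
      proof (rule sum_right_increments_le[OF \<delta>(2) q(2) _ disj])
        fix i assume "i \<in> q"
        then have "(fst i, snd i) \<in> p" "fst i \<in> N" by (auto simp: q_def)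
        then show "Inf (snd i) \<le> fst i \<and> fst i \<le> Sup (snd i) \<and>
            Sup (snd i) < fst i + \<delta> (fst i) \<and> fst i \<in> N"
          using K(2,3,5)[of "fst i" "snd i"] by (simp add: r_def)
      qed
      have sL: "(\<Sum>i\<in>q. norm (F (- (- Inf (snd i))) - F (- (- fst i)))) \<le> \<epsilon> / 4"
      proof (rule sum_right_increments_le[OF \<delta>'(2) q(2)])
        fix i assume "i \<in> q"
        then have "(fst i, snd i) \<in> p" "fst i \<in> N" by (auto simp: q_def)
        then show "- Sup (snd i) \<le> - fst i \<and> - fst i \<le> - Inf (snd i) \<and>
            - Inf (snd i) < - fst i + \<delta>' (- fst i) \<and> - fst i \<in> uminus ` N"
          using K(2,3,4)[of "fst i" "snd i"] by (simp add: r_def)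
      next
        have "{- Sup (snd i)<..<- Inf (snd i)} = uminus ` {Inf (snd i)<..<Sup (snd i)}"
          for i :: "real \<times> real set" by simp
        then show "disjoint_family_on (\<lambda>i. {- Sup (snd i)<..<- Inf (snd i)}) q"
          using disj unfolding disjoint_family_on_def by (simp only:) (metis image_Int image_empty inj_uminus)
      qed
      have "norm (\<Sum>i\<in>q. ?t i) \<le> (\<Sum>i\<in>q. norm (F (Sup (snd i)) - F (fst i)) + norm (F (Inf (snd i)) - F (fst i)))"
      proof (rule sum_norm_le)
        fix i assume "i \<in> q"
        then have "?t i = (F (Inf (snd i)) - F (fst i)) - (F (Sup (snd i)) - F (fst i))"
          by (simp add: q_def h_def)
        then show "norm (?t i) \<le> norm (F (Sup (snd i)) - F (fst i)) + norm (F (Inf (snd i)) - F (fst i))"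
          using norm_triangle_ineq4 by (metis add.commute)
      qed
      also have "\<dots> \<le> \<epsilon> / 4 + \<epsilon> / 4"
        unfolding sum.distrib using sR sL by (intro add_mono) auto
      finally have on_N: "norm (\<Sum>i\<in>q. ?t i) \<le> \<epsilon> / 2" by simp
      have "norm (\<Sum>i\<in>p - q. ?t i) \<le> (\<Sum>i\<in>p - q. \<eta> * (Sup (snd i) - Inf (snd i)))"
      proof (rule sum_norm_le)
        fix i assume i: "i \<in> p - q"
        define x s t where "x = fst i" and "s = Inf (snd i)" and "t = Sup (snd i)"
        have xi: "(x, snd i) \<in> p" "x \<notin> N" using i by (auto simp: q_def x_def)
        have st: "s \<le> x" "x \<le> t" "x - r x < s" "t < x + r x" "snd i = {s..t}"
          using K[OF xi(1)] unfolding s_def t_def by auto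
        have "norm (F s - F x - (s - x) *\<^sub>R g x) \<le> \<eta> * (x - s)"
          using d(2)[OF xi(2), of s] st by (simp add: r_def)
        moreover have "norm (F t - F x - (t - x) *\<^sub>R g x) \<le> \<eta> * (t - x)"
          using d(2)[OF xi(2), of t] st by (simp add: r_def)
        moreover have "?t i = (F s - F x - (s - x) *\<^sub>R g x) - (F t - F x - (t - x) *\<^sub>R g x)"
          using st xi by (simp add: h_def x_def[symmetric] s_def[symmetric] t_def[symmetric] algebra_simps)
        moreover have "\<eta> * (x - s) + \<eta> * (t - x) = \<eta> * (t - s)" by (simp add: algebra_simps)
        ultimately show "norm (?t i) \<le> \<eta> * (Sup (snd i) - Inf (snd i))"
          unfolding s_def[symmetric] t_def[symmetric]
          by (metis (no_types, lifting) add_mono norm_triangle_le_diff order_refl)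
      qed
      also have "\<dots> \<le> (\<Sum>i\<in>p. \<eta> * (Sup (snd i) - Inf (snd i)))"
      proof (rule sum_mono2)
        fix i assume "i \<in> p - (p - q)"
        then have "(fst i, snd i) \<in> p" by auto
        from K(2,3)[OF this] show "0 \<le> \<eta> * (Sup (snd i) - Inf (snd i))" using \<open>0 < \<eta>\<close> by simp
      qed (use finp in auto)
      also have "\<dots> = \<eta> * (b - a)"
        unfolding ba(1) by (simp add: sum_distrib_left case_prod_unfold)
      also have "\<dots> \<le> \<eta> * c" using \<open>0 < \<eta>\<close> by (intro mult_left_mono) (auto simp: c_def)
      also have "\<dots> = \<epsilon> / 4" using \<open>0 < c\<close> by (simp add: \<eta>_def)
      also have "\<dots> < \<epsilon> / 2" using \<open>0 < \<epsilon>\<close> by simp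
      finally have off_N: "norm (\<Sum>i\<in>p - q. ?t i) < \<epsilon> / 2" .
      have "(\<Sum>(x, K)\<in>p. Henstock_Kurzweil_Integration.content K *\<^sub>R h x) - (F b - F a) = (\<Sum>i\<in>p. ?t i)"
        unfolding ba(2) case_prod_unfold by (rule sum_subtractf[symmetric])
      also have "\<dots> = (\<Sum>i\<in>p - q. ?t i) + (\<Sum>i\<in>q. ?t i)"
        using sum.subset_diff[OF q(1) finp] .
      finally show ?thesis using on_N off_N norm_triangle_lt[of "\<Sum>i\<in>p - q. ?t i" "\<Sum>i\<in>q. ?t i" \<epsilon>] by simp
    qed
    ultimately show "\<exists>\<gamma>. gauge \<gamma> \<and> (\<forall>\<D>. \<D> tagged_division_of cbox a b \<and> \<gamma> fine \<D> \<longrightarrow>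
        norm ((\<Sum>(x, K)\<in>\<D>. Henstock_Kurzweil_Integration.content K *\<^sub>R h x) - (F b - F a)) < \<epsilon>)"
      by (intro exI[of _ "\<lambda>x. ball x (r x)"]) simp
  qed
  then have "(h has_integral (F b - F a)) {a..b}" by simp
  then show ?thesis by (rule has_integral_spike[OF N, rotated]) (simp add: h_def)
qed

section \<open>Reflections of \<open>ACG\<^sub>*\<close> functions and products with Lipschitz functions\<close>

text \<open>Reflection turns the one-sided results above into their mirror images.\<close>

lemma AC_star_reflect:
  assumes "AC_star F E"
  shows "AC_star (\<lambda>x. F (- x)) (uminus ` E)"
  unfolding AC_star_def
proof (intro allI impI)
  fix \<epsilon> :: real assume "0 < \<epsilon>"
  then obtain \<delta> where \<delta>: "0 < \<delta>" "\<And>C. finite C \<Longrightarrow> \<forall>(s, t)\<in>C. s \<in> E \<and> t \<in> E \<and> s < t \<Longrightarrow>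
      disjoint_family_on (\<lambda>(s, t). {s<..<t}) C \<Longrightarrow> (\<Sum>(s, t)\<in>C. \<bar>t - s\<bar>) < \<delta> \<Longrightarrow>
      (\<Sum>(s, t)\<in>C. oscillation F s t) < ereal \<epsilon>"
    by (rule AC_starE[OF assms]) (rule that)
  have "(\<Sum>(s, t)\<in>C. oscillation (\<lambda>x. F (- x)) s t) < ereal \<epsilon>"
    if C: "finite C" "\<forall>(s, t)\<in>C. s \<in> uminus ` E \<and> t \<in> uminus ` E \<and> s < t"
      "disjoint_family_on (\<lambda>(s, t). {s<..<t}) C" "(\<Sum>(s, t)\<in>C. \<bar>t - s\<bar>) < \<delta>" for C
  proof -
    let ?r = "\<lambda>(s, t). (- t, - s :: real)"
    have inj: "inj_on ?r C" by (auto simp: inj_on_def)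
    have "(\<Sum>(s, t)\<in>C. oscillation (\<lambda>x. F (- x)) s t) \<le> (\<Sum>(s, t)\<in>C. oscillation F (- t) (- s))"
    proof (intro sum_mono, clarify)
      fix s t
      have "ereal \<bar>F (- p) - F (- q)\<bar> \<le> oscillation F (- t) (- s)" if "s \<le> p" "p \<le> q" "q \<le> t" for p q
        using oscillation_ge[of "- t" "- q" "- p" "- s" F] that by (simp add: abs_minus_commute)
      then show "oscillation (\<lambda>x. F (- x)) s t \<le> oscillation F (- t) (- s)"
        unfolding oscillation_def[of "\<lambda>x. F (- x)"] by (intro SUP_least) auto
    qed
    also have "\<dots> = (\<Sum>(s, t)\<in>?r ` C. oscillation F s t)"
      unfolding sum.reindex[OF inj] by (simp add: case_prod_unfold)
    also have "\<dots> < ereal \<epsilon>"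
    proof (rule \<delta>(2))
      show "\<forall>(s, t)\<in>?r ` C. s \<in> E \<and> t \<in> E \<and> s < t" using C(2) by force
      have refl: "(case ?r i of (s, t) \<Rightarrow> {s<..<t}) = uminus ` (case i of (s, t) \<Rightarrow> {s<..<t})" for i
        by (cases i) simp
      have "disjoint_family_on (\<lambda>i. case ?r i of (s, t) \<Rightarrow> {s<..<t}) C"
        unfolding refl using C(3) by (fastforce simp: disjoint_family_on_def)
      then show "disjoint_family_on (\<lambda>(s, t). {s<..<t}) (?r ` C)"
        by (rule disjoint_family_on_image)
      show "(\<Sum>(s, t)\<in>?r ` C. \<bar>t - s\<bar>) < \<delta>"
        using C(4) unfolding sum.reindex[OF inj] by (simp add: case_prod_unfold)
    qed (use C(1) in simp)
    finally show ?thesis .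
  qed
  then show "\<exists>\<delta>>0. \<forall>C. finite C \<longrightarrow> (\<forall>(s, t)\<in>C. s \<in> uminus ` E \<and> t \<in> uminus ` E \<and> s < t) \<longrightarrow>
      disjoint_family_on (\<lambda>(s, t). {s<..<t}) C \<longrightarrow> (\<Sum>(s, t)\<in>C. \<bar>t - s\<bar>) < \<delta> \<longrightarrow>
      (\<Sum>(s, t)\<in>C. oscillation (\<lambda>x. F (- x)) s t) < ereal \<epsilon>"
    using \<delta>(1) by (intro exI[of _ \<delta>]) simp
qed

lemma ACG_star_reflect:
  assumes "ACG_star F"
  shows "ACG_star (\<lambda>x. F (- x))"
proof -
  have "continuous_on UNIV F" using assms by (simp add: ACG_star_def)
  then have "continuous_on UNIV (\<lambda>x. F (- x))"
    using continuous_on_compose2[of UNIV F UNIV uminus] by (simp add: continuous_on_minus)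
  moreover obtain E :: "nat \<Rightarrow> real set" where E: "(\<Union>n. E n) = UNIV" "\<And>n. AC_star F (E n)"
    using assms unfolding ACG_star_def by blast
  have "x \<in> (\<Union>n. uminus ` E n)" for x
  proof -
    obtain n where "- x \<in> E n" using E(1) by blast
    then show ?thesis by force
  qed
  then have "(\<Union>n. uminus ` E n) = UNIV" by blast
  ultimately show ?thesis
    unfolding ACG_star_def using AC_star_reflect[OF E(2)]
    by (intro conjI exI[of _ "\<lambda>n. uminus ` E n"]) auto
qed

text \<open>This makes null variation of the identity, that is, small total length of the intervals, a case of
  the general result.\<close>

lemma ACG_star_ident: "ACG_star (\<lambda>x. x)"
proof -
  have "AC_star (\<lambda>x. x) UNIV"
    unfolding AC_star_def
  proof (intro allI impI)
    fix \<epsilon> :: real assume "0 < \<epsilon>"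
    have "(\<Sum>(s, t)\<in>C. oscillation (\<lambda>x. x) s t) < ereal \<epsilon>" if "(\<Sum>(s, t)\<in>C. \<bar>t - s\<bar>) < \<epsilon>" for C
    proof -
      have "(\<Sum>(s, t)\<in>C. oscillation (\<lambda>x. x) s t) \<le> (\<Sum>i\<in>C. ereal (case i of (s, t) \<Rightarrow> \<bar>t - s\<bar>))"
        by (intro sum_mono) (auto simp: oscillation_le_iff)
      also have "\<dots> = ereal (\<Sum>(s, t)\<in>C. \<bar>t - s\<bar>)" by (rule sum_ereal)
      also have "\<dots> < ereal \<epsilon>" using that by simp
      finally show ?thesis .
    qed
    then show "\<exists>\<delta>>0. \<forall>C. finite C \<longrightarrow> (\<forall>(s, t)\<in>C. s \<in> UNIV \<and> t \<in> UNIV \<and> s < t) \<longrightarrow>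
        disjoint_family_on (\<lambda>(s, t). {s<..<t}) C \<longrightarrow> (\<Sum>(s, t)\<in>C. \<bar>t - s\<bar>) < \<delta> \<longrightarrow>
        (\<Sum>(s, t)\<in>C. oscillation (\<lambda>x. x) s t) < ereal \<epsilon>"
      using \<open>0 < \<epsilon>\<close> by (intro exI[of _ \<epsilon>]) simp
  qed
  then show ?thesis unfolding ACG_star_def by (intro conjI exI[of _ "\<lambda>_. UNIV"]) auto
qed

text \<open>By the product rule for increments, those of \<open>f e\<close> are bounded by the increments of \<open>f\<close> plus a
  multiple of the lengths of the intervals. The multiple involves a bound for \<open>f\<close>, so \<open>N\<close> is first
  cut into bounded pieces, where the compactness of intervals gives one.\<close>

lemma null_variation_right_scaleR:
  fixes e :: "real \<Rightarrow> 'a::real_normed_vector"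
  assumes f: "ACG_star f" and N: "negligible N"
    and bnd: "\<And>x. norm (e x) \<le> 1" and lip: "\<And>x y. norm (e x - e y) \<le> L * \<bar>x - y\<bar>"
  shows "null_variation_right (\<lambda>x. f x *\<^sub>R e x) N"
proof -
  have "null_variation_right (\<lambda>x. f x *\<^sub>R e x) (N \<inter> {- real m..real m})" for m
  proof (rule null_variation_rightI)
    fix \<epsilon> :: real assume "0 < \<epsilon>"
    have "compact (f ` {- real m..real m + 1})"
      using f by (intro compact_continuous_image) (auto simp: ACG_star_def intro: continuous_on_subset)
    then obtain B where B: "0 < B" "\<And>x. x \<in> {- real m..real m + 1} \<Longrightarrow> \<bar>f x\<bar> \<le> B"
      using compact_imp_bounded bounded_pos by (metis imageI real_norm_def)
    \<comment> \<open>The term 1 makes \<open>K\<close> positive, so that division by it is harmless.\<close>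
    define K where "K = B * \<bar>L\<bar> + 1"
    have "0 < K" unfolding K_def using B(1) by (simp add: add_nonneg_pos)
    have nf: "null_variation_right f (N \<inter> {- real m..real m})"
      and ni: "null_variation_right (\<lambda>x::real. x) (N \<inter> {- real m..real m})"
      using ACG_star_imp_null_variation_right[OF f N] ACG_star_imp_null_variation_right[OF ACG_star_ident N]
      by (auto elim: null_variation_right_subset)
    obtain \<delta>1 where \<delta>1: "\<And>x. 0 < \<delta>1 x" "right_increments_le f (N \<inter> {- real m..real m}) \<delta>1 (\<epsilon> / 2)"
      using null_variation_rightE[OF nf, of "\<epsilon> / 2"] \<open>0 < \<epsilon>\<close> by auto
    obtain \<delta>2 where \<delta>2: "\<And>x. 0 < \<delta>2 x"
      "right_increments_le (\<lambda>x::real. x) (N \<inter> {- real m..real m}) \<delta>2 (\<epsilon> / 2 / K)"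
      using null_variation_rightE[OF ni, of "\<epsilon> / 2 / K"] \<open>0 < \<epsilon>\<close> \<open>0 < K\<close> by auto
    define \<delta> where "\<delta> x = min (min (\<delta>1 x) (\<delta>2 x)) 1" for x
    have "right_increments_le (\<lambda>x. f x *\<^sub>R e x) (N \<inter> {- real m..real m}) \<delta> \<epsilon>"
    proof (rule right_increments_leI)
      fix T v assume T: "finite T" "T \<subseteq> N \<inter> {- real m..real m}" "\<forall>x\<in>T. x < v x \<and> v x < x + \<delta> x"
        "\<forall>x\<in>T. \<forall>y\<in>T. x < y \<longrightarrow> v x \<le> y"
      have s1: "(\<Sum>x\<in>T. norm (f (v x) - f x)) \<le> \<epsilon> / 2"
        by (rule right_increments_leD[OF \<delta>1(2)]) (use T in \<open>auto simp: \<delta>_def\<close>)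
      have s2: "(\<Sum>x\<in>T. norm (v x - x)) \<le> \<epsilon> / 2 / K"
        by (rule right_increments_leD[OF \<delta>2(2)]) (use T in \<open>auto simp: \<delta>_def\<close>)
      have "(\<Sum>x\<in>T. norm (f (v x) *\<^sub>R e (v x) - f x *\<^sub>R e x)) \<le>
          (\<Sum>x\<in>T. norm (f (v x) - f x) + K * norm (v x - x))"
      proof (rule sum_mono)
        fix x assume x: "x \<in> T"
        then have "v x \<in> {- real m..real m + 1}" using T(2,3) by (force simp: \<delta>_def)
        then have fB: "\<bar>f (v x)\<bar> \<le> B" by (rule B(2))
        have "L * \<bar>v x - x\<bar> \<le> \<bar>L\<bar> * \<bar>v x - x\<bar>" by (simp add: mult_right_mono)
        then have eL: "norm (e (v x) - e x) \<le> \<bar>L\<bar> * \<bar>v x - x\<bar>" using lip[of "v x" x] by linarith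
        have "f (v x) *\<^sub>R e (v x) - f x *\<^sub>R e x = (f (v x) - f x) *\<^sub>R e x + f (v x) *\<^sub>R (e (v x) - e x)"
          by (simp add: algebra_simps)
        then have "norm (f (v x) *\<^sub>R e (v x) - f x *\<^sub>R e x) \<le>
            \<bar>f (v x) - f x\<bar> * norm (e x) + \<bar>f (v x)\<bar> * norm (e (v x) - e x)"
          by (metis norm_scaleR norm_triangle_ineq)
        also have "\<dots> \<le> \<bar>f (v x) - f x\<bar> * 1 + B * (\<bar>L\<bar> * \<bar>v x - x\<bar>)"
          using bnd fB eL B(1) by (intro add_mono mult_mono) auto
        also have "\<dots> \<le> norm (f (v x) - f x) + K * norm (v x - x)"
          by (simp add: K_def algebra_simps)
        finally show "norm (f (v x) *\<^sub>R e (v x) - f x *\<^sub>R e x) \<le> norm (f (v x) - f x) + K * norm (v x - x)" .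
      qed
      also have "\<dots> = (\<Sum>x\<in>T. norm (f (v x) - f x)) + K * (\<Sum>x\<in>T. norm (v x - x))"
        by (simp add: sum.distrib sum_distrib_left)
      also have "\<dots> \<le> \<epsilon> / 2 + K * (\<epsilon> / 2 / K)"
        using s1 s2 \<open>0 < K\<close> by (intro add_mono mult_left_mono) auto
      also have "\<dots> = \<epsilon>" using \<open>0 < K\<close> by simp
      finally show "(\<Sum>x\<in>T. norm (f (v x) *\<^sub>R e (v x) - f x *\<^sub>R e x)) \<le> \<epsilon>" .
    qed
    moreover have "\<forall>x. 0 < \<delta> x" using \<delta>1(1) \<delta>2(1) by (simp add: \<delta>_def)
    ultimately show "\<exists>\<delta>. (\<forall>x. 0 < \<delta> x) \<and>
        right_increments_le (\<lambda>x. f x *\<^sub>R e x) (N \<inter> {- real m..real m}) \<delta> \<epsilon>" by blast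
  qed
  then have "null_variation_right (\<lambda>x. f x *\<^sub>R e x) (\<Union>m. N \<inter> {- real m..real m})"
    by (rule null_variation_right_UN)
  then show ?thesis
  proof (rule null_variation_right_subset, intro subsetI)
    fix x assume "x \<in> N"
    obtain m where "\<bar>x\<bar> < real m" using reals_Archimedean2 by blast
    then have "x \<in> {- real m..real m}" by auto
    with \<open>x \<in> N\<close> show "x \<in> (\<Union>m. N \<inter> {- real m..real m})" by blast
  qed
qed

section \<open>Integration by parts with the Fourier kernel\<close>

lemma has_vector_derivative_fourier_kernel:
  "((\<lambda>x. exp (- (\<i> * of_real s * of_real x))) has_vector_derivative
    - (\<i> * of_real s) * exp (- (\<i> * of_real s * of_real x))) (at x within S)"
  by (rule has_vector_derivative_real_field[where f = "\<lambda>z. exp (- (\<i> * of_real s * z))"])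
    (auto intro!: derivative_eq_intros)

lemma norm_fourier_kernel: "norm (exp (- (\<i> * of_real s * of_real x))) = 1"
  using norm_exp_i_times[of "- (s * x)"] by (simp add: mult.assoc)

lemma fourier_kernel_lipschitz:
  "norm (exp (- (\<i> * of_real s * of_real x)) - exp (- (\<i> * of_real s * of_real y))) \<le> \<bar>s\<bar> * \<bar>x - y\<bar>"
proof -
  let ?e = "\<lambda>x. exp (- (\<i> * of_real s * of_real x))"
  have "norm (?e x - ?e y) \<le> \<bar>s\<bar> * norm (x - y)"
  proof (rule differentiable_bound[of UNIV ?e "\<lambda>x h. h *\<^sub>R (- (\<i> * of_real s) * ?e x)"])
    fix x
    show "(?e has_derivative (\<lambda>h. h *\<^sub>R (- (\<i> * of_real s) * ?e x))) (at x within UNIV)"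
      using has_vector_derivative_fourier_kernel[of s x UNIV] unfolding has_vector_derivative_def .
    show "onorm (\<lambda>h. h *\<^sub>R (- (\<i> * of_real s) * ?e x)) \<le> \<bar>s\<bar>"
      by (rule onorm_le) (simp add: norm_mult norm_fourier_kernel)
  qed auto
  then show ?thesis by simp
qed

lemma ACG_star_fundamental_theorem_fourier:
  assumes f: "ACG_star f" and "a \<le> b"
  shows "(fourier_integrand (deriv f) s has_integral
    fourier_integrand f s b - fourier_integrand f s a +
    \<i> * of_real s * integral {a..b} (fourier_integrand f s)) {a..b}"
proof -
  let ?e = "\<lambda>x. exp (- (\<i> * of_real s * of_real x))"
  have fi: "fourier_integrand g s x = g x *\<^sub>R ?e x" for g x
    by (simp add: fourier_integrand_def scaleR_conv_of_real mult.commute)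
  define N where "N = {x. \<not> f differentiable (at x)}"
  have N: "negligible N" unfolding N_def by (rule ACG_star_imp_ae_differentiable[OF f])
  then have N': "negligible (uminus ` N)" 
    by (rule negligible_differentiable_image_negligible[OF order_refl]) (simp add: differentiable_on_minus)
  have "((\<lambda>x. fourier_integrand (deriv f) s x - \<i> * of_real s * fourier_integrand f s x) has_integral
      (fourier_integrand f s b - fourier_integrand f s a)) {a..b}"
  proof (rule fundamental_theorem_of_calculus_null_variation[OF \<open>a \<le> b\<close> N])
    show "(fourier_integrand f s has_vector_derivative
        fourier_integrand (deriv f) s x - \<i> * of_real s * fourier_integrand f s x) (at x)"
      if "x \<notin> N" for x
    proof -
      have "(f has_real_derivative deriv f x) (at x)"
        using that by (simp add: N_def DERIV_deriv_iff_real_differentiable)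
      then have "((\<lambda>x. f x *\<^sub>R ?e x) has_vector_derivative
          f x *\<^sub>R (- (\<i> * of_real s) * ?e x) + deriv f x *\<^sub>R ?e x) (at x)"
        by (rule has_vector_derivative_scaleR[OF _ has_vector_derivative_fourier_kernel])
      then show ?thesis unfolding fi[abs_def] by (simp add: algebra_simps)
    qed
    show "null_variation_right (fourier_integrand f s) N"
      unfolding fi[abs_def] using norm_fourier_kernel fourier_kernel_lipschitz
      by (intro null_variation_right_scaleR[OF f N]) auto
    show "null_variation_right (\<lambda>x. fourier_integrand f s (- x)) (uminus ` N)"
      unfolding fi[abs_def]
    proof (rule null_variation_right_scaleR[OF ACG_star_reflect[OF f] N'])
      show "norm (?e (- x)) \<le> 1" for x using norm_fourier_kernel[of s "- x"] by simp
      show "norm (?e (- x) - ?e (- y)) \<le> \<bar>s\<bar> * \<bar>x - y\<bar>" for x y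
        using fourier_kernel_lipschitz[of s "- x" "- y"] by (simp add: abs_minus_commute)
    qed
  qed
  moreover have "fourier_integrand f s integrable_on {a..b}"
    unfolding fi[abs_def] using f
    by (intro integrable_continuous_real continuous_intros) (auto simp: ACG_star_def intro: continuous_on_subset)
  then have "((\<lambda>x. \<i> * of_real s * fourier_integrand f s x) has_integral
      \<i> * of_real s * integral {a..b} (fourier_integrand f s)) {a..b}"
    by (intro has_integral_mult_right integrable_integral)
  ultimately have "((\<lambda>x. (fourier_integrand (deriv f) s x - \<i> * of_real s * fourier_integrand f s x) +
      \<i> * of_real s * fourier_integrand f s x) has_integral
      (fourier_integrand f s b - fourier_integrand f s a) +
      \<i> * of_real s * integral {a..b} (fourier_integrand f s)) {a..b}"
    by (rule has_integral_add)
  then show ?thesis by simp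
qed

text \<open>The case \<open>s = 0\<close> of integration by parts.\<close>

lemma ACG_star_fundamental_theorem:
  assumes "ACG_star f" "a \<le> b"
  shows "(deriv f has_integral (f b - f a)) {a..b}"
proof -
  have "(fourier_integrand (deriv f) 0 has_integral of_real (f b - f a)) {a..b}"
    using ACG_star_fundamental_theorem_fourier[OF assms, of 0] by (simp add: fourier_integrand_def)
  then have "((Re \<circ> fourier_integrand (deriv f) 0) has_integral Re (of_real (f b - f a))) {a..b}"
    by (rule has_integral_linear[OF _ bounded_linear_Re])
  then show ?thesis by (simp add: fourier_integrand_def o_def)
qed

section \<open>Passage to the whole line\<close>

lemma has_integral_UNIV_iff_real:
  fixes g :: "real \<Rightarrow> 'a::banach"
  shows "(g has_integral J) UNIV \<longleftrightarrow> (\<forall>a b. a \<le> b \<longrightarrow> g integrable_on {a..b}) \<and>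
    (\<forall>\<epsilon>>0. \<exists>B>0. \<forall>a b. a \<le> - B \<longrightarrow> B \<le> b \<longrightarrow> norm (integral {a..b} g - J) < \<epsilon>)"
proof -
  have "(\<forall>a b. g integrable_on {a..b}) \<longleftrightarrow> (\<forall>a b. a \<le> b \<longrightarrow> g integrable_on {a..b})"
    by (metis atLeastatMost_empty integrable_on_empty linorder_not_le)
  moreover have "ball 0 B \<subseteq> cbox a b \<longleftrightarrow> a \<le> - B \<and> B \<le> b" if "0 < B" for a b B :: real
    using that by (simp add: ball_eq_greaterThanLessThan greaterThanLessThan_subseteq_atLeastAtMost_iff)
  then have "(\<exists>B>0. \<forall>a b. ball 0 B \<subseteq> cbox a b \<longrightarrow> norm (integral {a..b} g - J) < \<epsilon>) \<longleftrightarrow>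
      (\<exists>B>0. \<forall>a b. a \<le> - B \<longrightarrow> B \<le> b \<longrightarrow> norm (integral {a..b} g - J) < \<epsilon>)" for \<epsilon>
    by metis
  ultimately show ?thesis by (subst has_integral_alt') simp
qed

text \<open>The boundary term \<open>R\<close> and the constant \<open>c\<close> are arbitrary because the lemma is used in both
  directions: solving integration by parts for the other integral, with \<open>c = i s\<close>, gives a formula
  of the same shape with constant \<open>1 / c\<close> and boundary term \<open>- R / c\<close>.\<close>

lemma has_integral_UNIV_transfer:
  fixes h k :: "real \<Rightarrow> complex"
  assumes h: "\<And>a b. a \<le> b \<Longrightarrow> (h has_integral R b - R a + c * integral {a..b} k) {a..b}"
    and R: "(R \<longlongrightarrow> 0) at_infinity" and k: "(k has_integral K) UNIV"
  shows "(h has_integral c * K) UNIV"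
  unfolding has_integral_UNIV_iff_real
proof (intro conjI allI impI)
  show "h integrable_on {a..b}" if "a \<le> b" for a b using h[OF that] by blast
  fix \<epsilon> :: real assume "0 < \<epsilon>"
  define \<eta> where "\<eta> = \<epsilon> / (norm c + 2)"
  have c2: "0 < norm c + 2" by (simp add: add_nonneg_pos)
  then have "0 < \<eta>" using \<open>0 < \<epsilon>\<close> by (simp add: \<eta>_def)
  then obtain B where B: "0 < B" "\<And>a b. a \<le> - B \<Longrightarrow> B \<le> b \<Longrightarrow> norm (integral {a..b} k - K) < \<eta>"
    using k unfolding has_integral_UNIV_iff_real by meson
  obtain M where M: "\<And>x. M \<le> \<bar>x\<bar> \<Longrightarrow> norm (R x) < \<eta>"
    using tendstoD[OF R \<open>0 < \<eta>\<close>] unfolding eventually_at_infinity by auto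
  have "norm (integral {a..b} h - c * K) < \<epsilon>" if "a \<le> - max B M" "max B M \<le> b" for a b
  proof -
    have "a \<le> b" "a \<le> - B" "B \<le> b" "M \<le> \<bar>a\<bar>" "M \<le> \<bar>b\<bar>" using that B(1) by linarith+
    then have "integral {a..b} h - c * K = R b - R a + c * (integral {a..b} k - K)"
      using integral_unique[OF h] by (simp add: algebra_simps)
    then have "norm (integral {a..b} h - c * K) \<le> norm (R b) + norm (R a) + norm c * norm (integral {a..b} k - K)"
      by (metis norm_mult norm_triangle_ineq norm_triangle_ineq4 order_trans add_right_mono)
    also have "\<dots> < \<eta> + \<eta> + norm c * \<eta>"
      using M[OF \<open>M \<le> \<bar>a\<bar>\<close>] M[OF \<open>M \<le> \<bar>b\<bar>\<close>] less_imp_le[OF B(2)[OF \<open>a \<le> - B\<close> \<open>B \<le> b\<close>]]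
      by (intro add_less_le_mono add_strict_mono mult_left_mono) auto
    also have "\<dots> = (norm c + 2) * \<eta>" by (simp add: algebra_simps)
    also have "\<dots> = \<epsilon>" using c2 by (simp add: \<eta>_def)
    finally show ?thesis .
  qed
  then show "\<exists>B>0. \<forall>a b. a \<le> - B \<longrightarrow> B \<le> b \<longrightarrow> norm (integral {a..b} h - c * K) < \<epsilon>"
    using B(1) by (intro exI[of _ "max B M"]) auto
qed

lemma fourier_deriv_if_vanishing_at_infinity:
  assumes f: "ACG_star f" and lim: "(f \<longlongrightarrow> 0) at_infinity" and "s \<noteq> 0"
  shows "(\<not> fourier_exists f s \<and> \<not> fourier_exists (deriv f) s) \<or>
    (fourier_exists f s \<and> fourier_exists (deriv f) s \<and>
     fourier (deriv f) s = \<i> * of_real s * fourier f s)"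
proof -
  let ?g = "fourier_integrand f s" and ?g' = "fourier_integrand (deriv f) s"
  let ?c = "\<i> * of_real s :: complex"
  have "?c \<noteq> 0" using \<open>s \<noteq> 0\<close> by simp
  have parts: "(?g' has_integral ?g b - ?g a + ?c * integral {a..b} ?g) {a..b}" if "a \<le> b" for a b
    by (rule ACG_star_fundamental_theorem_fourier[OF f that])
  have "norm (?g x) = norm (f x)" for x
    by (simp add: fourier_integrand_def norm_mult norm_fourier_kernel)
  then have g0: "(?g \<longlongrightarrow> 0) at_infinity"
    using lim by (subst tendsto_norm_zero_iff[symmetric]) (simp add: tendsto_rabs_zero_iff)
  have forward: "(?g' has_integral ?c * K) UNIV" if "(?g has_integral K) UNIV" for K
    using has_integral_UNIV_transfer[OF parts g0 that] .
  have backward: "(?g has_integral inverse ?c * K) UNIV" if "(?g' has_integral K) UNIV" for K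
  proof (rule has_integral_UNIV_transfer[of _ "\<lambda>x. - (inverse ?c) * ?g x", OF _ _ that])
    show "((\<lambda>x. - (inverse ?c) * ?g x) \<longlongrightarrow> 0) at_infinity"
      using tendsto_mult_right_zero[OF g0] by blast
    fix a b :: real assume "a \<le> b"
    have "?g integrable_on {a..b}"
      using f unfolding fourier_integrand_def[abs_def]
      by (intro integrable_continuous_real continuous_intros) (auto simp: ACG_star_def intro: continuous_on_subset)
    then have "(?g has_integral integral {a..b} ?g) {a..b}" by (rule integrable_integral)
    moreover have "integral {a..b} ?g' = ?g b - ?g a + ?c * integral {a..b} ?g"
      using parts[OF \<open>a \<le> b\<close>] by (rule integral_unique)
    then have "integral {a..b} ?g =
        - (inverse ?c) * ?g b - (- (inverse ?c) * ?g a) + inverse ?c * integral {a..b} ?g'"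
      using \<open>s \<noteq> 0\<close> by (simp add: field_simps)
    ultimately show "(?g has_integral
        - (inverse ?c) * ?g b - (- (inverse ?c) * ?g a) + inverse ?c * integral {a..b} ?g') {a..b}"
      by simp
  qed
  show ?thesis
  proof (cases "fourier_exists f s")
    case True
    then have "(?g has_integral fourier f s) UNIV"
      unfolding fourier_exists_def fourier_def by (rule integrable_integral)
    from forward[OF this] have "fourier_exists (deriv f) s" "fourier (deriv f) s = ?c * fourier f s"
      unfolding fourier_exists_def fourier_def[of "deriv f"] by (auto intro: integral_unique)
    then show ?thesis using True by blast
  next
    case False
    then show ?thesis using backward unfolding fourier_exists_def integrable_on_def by blast
  qed
qed

text \<open>Over an interval of length \<open>1 / \<epsilon>\<close> the integral of \<open>f\<close> differs from \<open>f b / \<epsilon>\<close> by at most \<open>1\<close>.\<close>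

lemma small_if_oscillation_and_integral_small:
  fixes f :: "real \<Rightarrow> real"
  assumes cont: "continuous_on UNIV f" and "0 < \<epsilon>"
    and osc: "\<And>x. b \<le> x \<Longrightarrow> \<bar>f x - f b\<bar> \<le> \<epsilon>"
    and int: "\<And>x. b \<le> x \<Longrightarrow> \<bar>integral {b..x} f\<bar> \<le> 1"
  shows "\<bar>f b\<bar> \<le> 2 * \<epsilon>"
proof -
  define x where "x = b + 1 / \<epsilon>"
  have "b \<le> x" using \<open>0 < \<epsilon>\<close> by (simp add: x_def)
  have fint: "f integrable_on {b..x}"
    using cont by (intro integrable_continuous_real) (auto intro: continuous_on_subset)
  have "integral {b..x} (\<lambda>y. f y - f b) = integral {b..x} f - (x - b) * f b"
    using Henstock_Kurzweil_Integration.integral_diff[OF fint integrable_const_ivl[of "f b" b x]] \<open>b \<le> x\<close>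
    by simp
  moreover have "norm (integral {b..x} (\<lambda>y. f y - f b)) \<le> \<epsilon> * (x - b)"
    using cont osc by (intro integral_bound[OF \<open>b \<le> x\<close>] continuous_intros)
      (auto intro: continuous_on_subset)
  ultimately have "\<bar>integral {b..x} f - f b / \<epsilon>\<bar> \<le> 1" using \<open>0 < \<epsilon>\<close> by (simp add: x_def)
  then have "\<bar>f b / \<epsilon>\<bar> \<le> 2" using int[OF \<open>b \<le> x\<close>] by linarith
  then show ?thesis using \<open>0 < \<epsilon>\<close> by (simp add: abs_divide pos_divide_le_eq)
qed

lemma integrable_UNIV_Cauchy:
  fixes g :: "real \<Rightarrow> 'a::banach"
  assumes "g integrable_on UNIV" "0 < \<epsilon>"
  obtains B where "0 < B" "\<And>x y. B \<le> x \<Longrightarrow> x \<le> y \<Longrightarrow> norm (integral {x..y} g) \<le> \<epsilon>"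
    "\<And>x y. x \<le> y \<Longrightarrow> y \<le> - B \<Longrightarrow> norm (integral {x..y} g) \<le> \<epsilon>"
proof -
  obtain J where J: "(g has_integral J) UNIV" using assms(1) by blast
  have int: "g integrable_on {a..b}" for a b
    using integrable_on_subinterval[OF assms(1), of a b] by simp
  have "0 < \<epsilon> / 2" using assms(2) by simp
  then obtain B where B: "0 < B" "\<And>a b. a \<le> - B \<Longrightarrow> B \<le> b \<Longrightarrow> norm (integral {a..b} g - J) < \<epsilon> / 2"
    using J unfolding has_integral_UNIV_iff_real by meson
  show thesis
  proof
    show "0 < B" by (rule B)
    fix x y :: real
    show "norm (integral {x..y} g) \<le> \<epsilon>" if "B \<le> x" "x \<le> y"
    proof -
      have "integral {- B..x} g + integral {x..y} g = integral {- B..y} g"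
        using that B(1) by (intro Henstock_Kurzweil_Integration.integral_combine int) auto
      then have "integral {x..y} g = (integral {- B..y} g - J) - (integral {- B..x} g - J)"
        by (simp add: algebra_simps)
      then show ?thesis
        using norm_triangle_ineq4[of "integral {- B..y} g - J" "integral {- B..x} g - J"]
          B(2)[of "- B" y] B(2)[of "- B" x] that by simp
    qed
    show "norm (integral {x..y} g) \<le> \<epsilon>" if "x \<le> y" "y \<le> - B"
    proof -
      have "integral {x..y} g + integral {y..B} g = integral {x..B} g"
        using that B(1) by (intro Henstock_Kurzweil_Integration.integral_combine int) auto
      then have "integral {x..y} g = (integral {x..B} g - J) - (integral {y..B} g - J)"
        by (simp add: algebra_simps)
      then show ?thesis
        using norm_triangle_ineq4[of "integral {x..B} g - J" "integral {y..B} g - J"]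
          B(2)[of x B] B(2)[of y B] that by simp
    qed
  qed
qed

text \<open>Far out, integrability of \<open>f'\<close> bounds the oscillation of \<open>f\<close> and integrability of \<open>f\<close> bounds its
  integrals; the left half-line is handled by reflection.\<close>

lemma vanishes_at_infinity_if_integrable:
  assumes f: "ACG_star f" and "f integrable_on UNIV" "deriv f integrable_on UNIV"
  shows "(f \<longlongrightarrow> 0) at_infinity"
proof (rule tendstoI)
  fix e :: real assume "0 < e"
  define \<epsilon> where "\<epsilon> = e / 3"
  have "0 < \<epsilon>" "2 * \<epsilon> < e" using \<open>0 < e\<close> by (auto simp: \<epsilon>_def)
  have cont: "continuous_on UNIV f" using f by (simp add: ACG_star_def)
  then have cont': "continuous_on UNIV (\<lambda>x. f (- x))"
    using continuous_on_compose2[of UNIV f UNIV uminus] by (simp add: continuous_on_minus)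
  have ftc: "integral {x..y} (deriv f) = f y - f x" if "x \<le> y" for x y
    using ACG_star_fundamental_theorem[OF f that] by (rule integral_unique)
  obtain B where B: "0 < B" "\<And>x y. B \<le> x \<Longrightarrow> x \<le> y \<Longrightarrow> norm (integral {x..y} (deriv f)) \<le> \<epsilon>"
    "\<And>x y. x \<le> y \<Longrightarrow> y \<le> - B \<Longrightarrow> norm (integral {x..y} (deriv f)) \<le> \<epsilon>"
    by (rule integrable_UNIV_Cauchy[OF assms(3) \<open>0 < \<epsilon>\<close>]) (rule that)
  obtain B' where B': "0 < B'" "\<And>x y. B' \<le> x \<Longrightarrow> x \<le> y \<Longrightarrow> norm (integral {x..y} f) \<le> 1"
    "\<And>x y. x \<le> y \<Longrightarrow> y \<le> - B' \<Longrightarrow> norm (integral {x..y} f) \<le> 1"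
    by (rule integrable_UNIV_Cauchy[OF assms(2) zero_less_one]) (rule that)
  have "\<bar>f x\<bar> \<le> 2 * \<epsilon>" if "max B B' \<le> \<bar>x\<bar>" for x
  proof (cases "0 \<le> x")
    case True
    then have x: "B \<le> x" "B' \<le> x" using that by auto
    show ?thesis
      by (rule small_if_oscillation_and_integral_small[OF cont \<open>0 < \<epsilon>\<close>])
        (use B(2)[OF x(1)] B'(2)[OF x(2)] ftc in auto)
  next
    case False
    then have x: "x \<le> - B" "x \<le> - B'" using that by auto
    have "\<bar>f (- (- x))\<bar> \<le> 2 * \<epsilon>"
    proof (rule small_if_oscillation_and_integral_small[OF cont' \<open>0 < \<epsilon>\<close>])
      fix y assume y: "- x \<le> y"
      then have "- y \<le> x" by simp
      then show "\<bar>f (- y) - f (- (- x))\<bar> \<le> \<epsilon>"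
        using B(3)[OF _ x(1), of "- y"] ftc[of "- y" x] by (simp add: abs_minus_commute)
      have "integral {- x..y} (\<lambda>y. f (- y)) = integral {- y..x} f"
        using Henstock_Kurzweil_Integration.integral_reflect_real[of x "- y" f] by simp
      then show "\<bar>integral {- x..y} (\<lambda>y. f (- y))\<bar> \<le> 1"
        using B'(3)[OF \<open>- y \<le> x\<close> x(2)] by simp
    qed
    then show ?thesis by simp
  qed
  then show "\<forall>\<^sub>F x in at_infinity. dist (f x) 0 < e"
    unfolding eventually_at_infinity using \<open>2 * \<epsilon> < e\<close>
    by (intro exI[of _ "max B B'"]) (auto intro: le_less_trans)
qed

theorem proposition9:
  fixes f :: "real \<Rightarrow> real"
  shows
    "(ACG_star f \<and> (f \<longlongrightarrow> 0) at_infinity \<longrightarrow>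
      (\<forall>s::real. s \<noteq> 0 \<longrightarrow>
        (\<not> fourier_exists f s \<and> \<not> fourier_exists (deriv f) s) \<or>
        (fourier_exists f s \<and> fourier_exists (deriv f) s \<and>
         fourier (deriv f) s = \<i> * of_real s * fourier f s)))
     \<and>
     (ACG_star f \<and> f integrable_on UNIV \<and> deriv f integrable_on UNIV \<longrightarrow>
      (\<forall>s::real. s \<noteq> 0 \<longrightarrow>
        (\<not> fourier_exists f s \<and> \<not> fourier_exists (deriv f) s) \<or>
        (fourier_exists f s \<and> fourier_exists (deriv f) s \<and>
         fourier (deriv f) s = \<i> * of_real s * fourier f s)))"
  using fourier_deriv_if_vanishing_at_infinity vanishes_at_infinity_if_integrable by blast

end
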